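(* For every integer $n \ge 10$ of the form $n = 6k + 4$ with $k$ a positive integer, we have $\mathbf{car}(n, 2) \ge 2^{(n - 4)/3}$.
   Context: A partial deterministic finite (semi-)automaton (partial DFA) is a triple $\mathcal{A} = (Q, \Sigma, \delta)$ with $Q$ a finite set of states, $\Sigma$ a finite alphabet, and $\delta \colon Q \times \Sigma \rightharpoonup Q$ a partial transition function, extended to words $\delta\colon Q \times \Sigma^* \rightharpoonup Q$ in the usual way ($\delta(q,\varepsilon)=q$, $\delta(q, wa) = \delta(\delta(q,w),a)$, undefined if any step is undefined). A word $w \in \Sigma^*$ is carefully synchronising for $\mathcal{A}$ if there is a state $q \in Q$ such that $\delta(p, w)$ is defined and equals $q$ for every $p \in Q$. $\mathbf{car}(n, m)$ denotes the maximum, over all partial DFAs with $n$ states and $m$ letters that admit at least one carefully synchronising word, of the length of a shortest carefully synchronising word. *)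

theory Defs
  imports Complex_Main
begin

definition is_pdfa :: "nat \<Rightarrow> nat \<Rightarrow> (nat \<Rightarrow> nat \<Rightarrow> nat option) \<Rightarrow> bool" where
  "is_pdfa n m d \<longleftrightarrow> (\<forall>q<n. \<forall>a<m. \<forall>p. d q a = Some p \<longrightarrow> p < n)"

fun delta_word :: "(nat \<Rightarrow> nat \<Rightarrow> nat option) \<Rightarrow> nat \<Rightarrow> nat list \<Rightarrow> nat option" where
  "delta_word d q [] = Some q"
| "delta_word d q (a # w) = Option.bind (d q a) (\<lambda>p. delta_word d p w)"

definition careful_sync :: "nat \<Rightarrow> nat \<Rightarrow> (nat \<Rightarrow> nat \<Rightarrow> nat option) \<Rightarrow> nat list \<Rightarrow> bool" where
  "careful_sync n m d w \<longleftrightarrow> set w \<subseteq> {..<m} \<and> (\<exists>q<n. \<forall>p<n. delta_word d p w = Some q)"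

definition shortest_cs :: "nat \<Rightarrow> nat \<Rightarrow> (nat \<Rightarrow> nat \<Rightarrow> nat option) \<Rightarrow> nat" where
  "shortest_cs n m d = (LEAST l. \<exists>w. careful_sync n m d w \<and> length w = l)"

definition car :: "nat \<Rightarrow> nat \<Rightarrow> nat" where
  "car n m = Sup {shortest_cs n m d | d. is_pdfa n m d \<and> (\<exists>w. careful_sync n m d w)}"

end

theory Submission
  imports Defs
begin

text \<open>
  A ring automaton makes two letters run a counter in base \<open>b\<close>. Its states are pairs of a position in a
  ring of odd length \<open>N\<close> and a label, and every letter moves all positions one step on, so the \<open>N\<close> tokens
  that survive a reset keep their cyclic order. One token is marked and the others are digits. The total
  letter 1 increments the digit at position 0, but it is harmless only if the token at position 2 is the
  mark or has just overflowed; otherwise an \<open>Err\<close> appears, which forbids the partial letter 0 until 1 has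
  reset everything. Hence reading the tokens in steps of two positions gives a counter whose carries
  are forced to be correct. Two tokens can be merged for the first time only when 1 meets the mark at
  position 0 while the last digit overflows, that is, after about \<open>N * b ^ (N - 1)\<close> letters. Once a token
  is gone there is a hole in the ring, and the remaining tokens can be removed one by one.

  With \<open>b = 4\<close> this automaton has \<open>6 * N + 4\<close> states, which settles odd \<open>k = N\<close>. For even \<open>k = N + 1\<close>
  six control states let the counter advance only at times divisible by 4, which more than doubles the
  length. For \<open>k = 6\<close> take \<open>N = 7\<close>, \<open>b = 3\<close>; for \<open>k \<le> 5\<close> the bound \<open>(n - 1)\<^sup>2\<close> of the Cerny automata is
  good enough.
\<close>

subsection \<open>Partial automata on arbitrary state sets\<close>

fun run :: "('s \<Rightarrow> nat \<Rightarrow> 's option) \<Rightarrow> 's \<Rightarrow> nat list \<Rightarrow> 's option" where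
  "run \<delta> q [] = Some q"
| "run \<delta> q (a # w) = Option.bind (\<delta> q a) (\<lambda>p. run \<delta> p w)"

lemma run_append: "run \<delta> q (u @ v) = Option.bind (run \<delta> q u) (\<lambda>p. run \<delta> p v)"
  by (induction u arbitrary: q) (auto split: bind_splits)

lemma run_closed:
  assumes "\<And>p a q. p \<in> A \<Longrightarrow> a < m \<Longrightarrow> \<delta> p a = Some q \<Longrightarrow> q \<in> A"
    and "set w \<subseteq> {..<m}" "p \<in> A" "run \<delta> p w = Some q"
  shows "q \<in> A"
  using assms(2-4) by (induction w arbitrary: p) (auto simp: bind_eq_Some_conv dest: assms(1))

lemma delta_word_append: "delta_word d q (u @ v) = Option.bind (delta_word d q u) (\<lambda>p. delta_word d p v)"
  by (induction u arbitrary: q) (auto split: bind_splits)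

lemma delta_word_lt:
  assumes "is_pdfa n m d" "set w \<subseteq> {..<m}" "p < n" "delta_word d p w = Some q"
  shows "q < n"
  using assms(2-4)
proof (induction w arbitrary: p)
  case (Cons a w)
  then obtain r where r: "d p a = Some r" "delta_word d r w = Some q"
    by (auto simp: bind_eq_Some_conv)
  then have "r < n" using assms(1) Cons.prems by (auto simp: is_pdfa_def)
  then show ?case using Cons r by auto
qed simp

text \<open>A shortest carefully synchronising word never repeats an image of the state set.\<close>

lemma shortest_cs_less:
  assumes pd: "is_pdfa n m d" and ex: "\<exists>w. careful_sync n m d w"
  shows "shortest_cs n m d < 2 ^ n"
proof -
  define l where "l = shortest_cs n m d"
  have "\<exists>w. careful_sync n m d w \<and> length w = l"
    unfolding l_def shortest_cs_def by (rule LeastI_ex) (use ex in auto)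
  then obtain w where w: "careful_sync n m d w" "length w = l" by auto
  have least: "l \<le> length w'" if "careful_sync n m d w'" for w'
    unfolding l_def shortest_cs_def by (rule Least_le) (use that in auto)
  obtain q where q: "q < n" "\<And>p. p < n \<Longrightarrow> delta_word d p w = Some q" and sw: "set w \<subseteq> {..<m}"
    using w(1) by (auto simp: careful_sync_def)
  define f where "f i = (\<lambda>p. the (delta_word d p (take i w))) ` {..<n}" for i
  have split: "\<exists>r<n. delta_word d p (take i w) = Some r \<and> delta_word d r (drop i w) = Some q" if "p < n" for p i
  proof -
    have "delta_word d p (take i w @ drop i w) = Some q" using q(2)[OF that] by simp
    then obtain r where r: "delta_word d p (take i w) = Some r" "delta_word d r (drop i w) = Some q"
      unfolding delta_word_append by (auto simp: bind_eq_Some_conv)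
    have "set (take i w) \<subseteq> {..<m}" using sw set_take_subset by fastforce
    from delta_word_lt[OF pd this that r(1)] r show ?thesis by auto
  qed
  have inj: "inj_on f {..l}"
  proof (rule linorder_inj_onI)
    fix i j assume ij: "i < j" "i \<in> {..l}" "j \<in> {..l}"
    show "f i \<noteq> f j"
    proof
      assume eq: "f i = f j"
      let ?v = "take i w @ drop j w"
      have "delta_word d p ?v = Some q" if p: "p < n" for p
      proof -
        obtain r where r: "r < n" "delta_word d p (take i w) = Some r" using split[OF p] by blast
        have "the (delta_word d p (take i w)) \<in> f i" unfolding f_def using p by blast
        then have "r \<in> f i" using r by simp
        then have "r \<in> f j" using eq by simp
        then obtain p' where p': "p' < n" "r = the (delta_word d p' (take j w))" by (auto simp: f_def)
        then have "delta_word d r (drop j w) = Some q" using split[OF p'(1), of j] by auto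
        then show ?thesis using r by (simp add: delta_word_append)
      qed
      moreover have "set ?v \<subseteq> {..<m}" using sw set_take_subset[of i w] set_drop_subset[of j w] by auto
      ultimately have "careful_sync n m d ?v" using q(1) by (auto simp: careful_sync_def)
      from least[OF this] show False using ij w(2) by auto
    qed
  qed auto
  have "the (delta_word d p (take i w)) < n" if "p < n" for p i
    using split[OF that, of i] by auto
  then have "f ` {..l} \<subseteq> Pow {..<n}" by (auto simp: f_def)
  then have "card (f ` {..l}) \<le> card (Pow {..<n})" by (intro card_mono) auto
  then have "l + 1 \<le> 2 ^ n" using card_image[OF inj] by (simp add: card_Pow)
  then show ?thesis by (simp add: l_def)
qed

text \<open>A \<open>Sup\<close> of naturals is an upper bound only for a bounded set; the bound
  \<open>2 ^ n\<close> comes from the number of subsets of the state set.\<close>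

lemma shortest_cs_le_car:
  assumes "is_pdfa n m d" "\<exists>w. careful_sync n m d w"
  shows "shortest_cs n m d \<le> car n m"
  unfolding car_def
proof (rule cSup_upper)
  show "shortest_cs n m d \<in> {shortest_cs n m d |d. is_pdfa n m d \<and> (\<exists>w. careful_sync n m d w)}"
    using assms by auto
  show "bdd_above {shortest_cs n m d |d. is_pdfa n m d \<and> (\<exists>w. careful_sync n m d w)}"
  proof (rule bdd_aboveI[of _ "2 ^ n"])
    fix l assume "l \<in> {shortest_cs n m d |d. is_pdfa n m d \<and> (\<exists>w. careful_sync n m d w)}"
    then obtain d where "l = shortest_cs n m d" "is_pdfa n m d" "\<exists>w. careful_sync n m d w" by blast
    then show "l \<le> 2 ^ n" using shortest_cs_less[of n m d] by simp
  qed
qed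

text \<open>An automaton on an arbitrary state set \<open>A\<close> is transported along a surjection
  \<open>f : {..<n} \<rightarrow> A\<close>; surplus numbers behave like the states of \<open>A\<close> they are mapped to.\<close>

lemma car_ge:
  assumes fin: "finite A" and ne: "A \<noteq> {}" and card: "card A \<le> n"
    and closed: "\<And>p a q. p \<in> A \<Longrightarrow> a < m \<Longrightarrow> \<delta> p a = Some q \<Longrightarrow> q \<in> A"
    and w0: "set w0 \<subseteq> {..<m}" "w0 \<noteq> []" "q0 \<in> A" "\<And>p. p \<in> A \<Longrightarrow> run \<delta> p w0 = Some q0"
    and lower: "\<And>w q. set w \<subseteq> {..<m} \<Longrightarrow> (\<And>p. p \<in> A \<Longrightarrow> run \<delta> p w = Some q) \<Longrightarrow> L \<le> length w"
  shows "L \<le> car n m"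
proof -
  obtain h where h: "bij_betw h A {..<card A}"
    using fin by (metis ex_bij_betw_finite_nat atLeast0LessThan)
  obtain s0 where s0: "s0 \<in> A" using ne by auto
  define f where "f i = (if i < card A then inv_into A h i else s0)" for i
  define g where "g = h"
  have fA: "f i \<in> A" for i
    using h s0 by (auto simp: f_def intro!: inv_into_into) (auto simp: bij_betw_def)
  have glt: "g s < card A" if "s \<in> A" for s using h that by (auto simp: g_def bij_betw_def)
  have gn: "g s < n" if "s \<in> A" for s using glt[OF that] card by simp
  have fg: "f (g s) = s" if "s \<in> A" for s
    using glt[OF that] h that by (auto simp: f_def g_def bij_betw_def)
  have ginj: "s = s'" if "s \<in> A" "s' \<in> A" "g s = g s'" for s s' using fg that by metis
  define d where "d q a = (if a < m then map_option g (\<delta> (f q) a) else None)" for q a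
  have pd: "is_pdfa n m d" unfolding is_pdfa_def d_def using closed[OF fA] gn by auto
  have dw: "delta_word d (g s) w = map_option g (run \<delta> s w)" if "s \<in> A" "set w \<subseteq> {..<m}" for s w
    using that
  proof (induction w arbitrary: s)
    case (Cons a w)
    then show ?case using closed[OF Cons.prems(1)]
      by (cases "\<delta> s a") (auto simp: d_def fg)
  qed simp
  \<comment> \<open>The first letter sends every number, surplus ones included, into the image of
    \<open>g\<close>; this is where nonemptiness of the word enters.\<close>
  have dw': "delta_word d q w = map_option g (run \<delta> (f q) w)" if "w \<noteq> []" "set w \<subseteq> {..<m}" for q w
  proof (cases w)
    case (Cons a v)
    then show ?thesis using that closed[OF fA[of q]] dw
      by (cases "\<delta> (f q) a") (auto simp: d_def)
  qed (use that in simp)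
  have "careful_sync n m d w0" unfolding careful_sync_def
    using w0 dw'[OF w0(2,1)] fA gn[OF w0(3)] by (intro conjI exI[of _ "g q0"]) auto
  then have ex: "\<exists>w. careful_sync n m d w" by blast
  have low: "L \<le> length w" if cs: "careful_sync n m d w" for w
  proof -
    obtain r where r: "r < n" "\<And>p. p < n \<Longrightarrow> delta_word d p w = Some r" and sw: "set w \<subseteq> {..<m}"
      using cs by (auto simp: careful_sync_def)
    have "run \<delta> s w = Some (f r)" if s: "s \<in> A" for s
    proof -
      have "map_option g (run \<delta> s w) = Some r" using dw[OF s sw] r(2)[OF gn[OF s]] by simp
      then obtain s' where s': "run \<delta> s w = Some s'" "g s' = r" by auto
      have "s' \<in> A" using run_closed[OF closed sw s s'(1)] .
      then show ?thesis using s' fg by auto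
    qed
    then show ?thesis using lower sw by blast
  qed
  have "L \<le> shortest_cs n m d"
    unfolding shortest_cs_def
    by (rule LeastI2_ex) (use ex low in auto)
  then show ?thesis using shortest_cs_le_car[OF pd ex] by simp
qed

definition leads :: "('s \<Rightarrow> nat \<Rightarrow> 's option) \<Rightarrow> nat list \<Rightarrow> 's set \<Rightarrow> 's set \<Rightarrow> bool" where
  "leads \<delta> w S T \<longleftrightarrow> (\<forall>p\<in>S. \<exists>q\<in>T. run \<delta> p w = Some q)"

lemma leads_Nil: "S \<subseteq> T \<Longrightarrow> leads \<delta> [] S T"
  by (auto simp: leads_def)

lemma leads_append: "leads \<delta> u S T \<Longrightarrow> leads \<delta> v T U \<Longrightarrow> leads \<delta> (u @ v) S U"
  by (fastforce simp: leads_def run_append)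

lemma leads_single: "leads \<delta> [a] S T \<longleftrightarrow> (\<forall>p\<in>S. \<exists>q\<in>T. \<delta> p a = Some q)"
  by (auto simp: leads_def bind_eq_Some_conv)

subsection \<open>Cerny automata\<close>

definition cerny :: "nat \<Rightarrow> nat \<Rightarrow> nat \<Rightarrow> nat option" where
  "cerny n q a = Some (if a = 0 then (q + 1) mod n else if q + 1 = n then 0 else q)"

lemma cerny_run_defined: "run (cerny n) p w \<noteq> None"
  by (induction w arbitrary: p) (auto simp: cerny_def)

lemma cerny_rotate: "run (cerny n) p (replicate j 0) = Some ((p + j) mod n)" if "p < n"
  using that
proof (induction j arbitrary: p)
  case (Suc j)
  have "run (cerny n) p (replicate (Suc j) 0) = run (cerny n) ((p + 1) mod n) (replicate j 0)"
    by (simp add: cerny_def)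
  also have "\<dots> = Some (((p + 1) mod n + j) mod n)" using Suc by simp
  also have "((p + 1) mod n + j) mod n = (p + Suc j) mod n" by (simp add: mod_add_left_eq)
  finally show ?case .
qed simp

text \<open>Rotating \<open>n - 1\<close> times is one step back. Followed by the merging letter it
  fixes 0 and lowers every other state by one, so each round shortens the initial segment of
  possible states.\<close>

lemma cerny_sync:
  assumes "2 \<le> n"
  shows "\<exists>w. set w \<subseteq> {..<2} \<and> w \<noteq> [] \<and> (\<forall>p<n. run (cerny n) p w = Some 0)"
proof -
  have "\<exists>w. set w \<subseteq> {..<2} \<and> w \<noteq> [] \<and> leads (cerny n) w {..<n} {..<n - 1 - i}" if "i \<le> n - 2" for i
    using that
  proof (induction i)
    case 0
    have "leads (cerny n) [1] {..<n} {..<n - 1}"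
      using assms by (auto simp: leads_single cerny_def)
    then show ?case by (intro exI[of _ "[1]"]) auto
  next
    case (Suc i)
    then obtain w where w: "set w \<subseteq> {..<2}" "w \<noteq> []" "leads (cerny n) w {..<n} {..<n - 1 - i}" by auto
    have "leads (cerny n) (replicate (n - 1) 0 @ [1]) {..<n - 1 - i} {..<n - 1 - Suc i}"
      unfolding leads_def
    proof
      fix p assume p: "p \<in> {..<n - 1 - i}"
      then have pn: "p < n" by auto
      have "run (cerny n) p (replicate (n - 1) 0) = Some ((p + (n - 1)) mod n)"
        using cerny_rotate[OF pn] .
      moreover have "(p + (n - 1)) mod n = (if p = 0 then n - 1 else p - 1)"
        using pn assms by (auto simp: mod_if)
      ultimately show "\<exists>q\<in>{..<n - 1 - Suc i}. run (cerny n) p (replicate (n - 1) 0 @ [1]) = Some q"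
        using p Suc.prems by (auto simp: run_append cerny_def)
    qed
    from leads_append[OF w(3) this] show ?case
      using w(1,2) by (intro exI[of _ "w @ replicate (n - 1) 0 @ [1]"]) auto
  qed
  from this[of "n - 2"] obtain w where "set w \<subseteq> {..<2}" "w \<noteq> []" "leads (cerny n) w {..<n} {..<n - 1 - (n - 2)}"
    by auto
  moreover have "n - 1 - (n - 2) = 1" using assms by simp
  ultimately show ?thesis by (auto simp: leads_def intro!: exI[of _ w])
qed

text \<open>A run of \<open>g\<close> consecutive positions ending in \<open>e\<close> that are missing from the image can only grow
  when its end is at \<open>n - 2\<close>, hence once every \<open>n\<close> letters.\<close>

lemma cerny_gap:
  assumes n: "2 \<le> n" and sw: "set w \<subseteq> {..<2}" and "e < n" "g < n"
    and "\<And>i. i < g \<Longrightarrow> (if i \<le> e then e - i else e + n - i) \<notin> (\<lambda>p. the (run (cerny n) p w)) ` {..<n}"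
  shows "n * g \<le> length w + (if e = n - 1 then n - 1 else n - 2 - e)"
  using assms(2-)
\<comment> \<open>The summand added to \<open>length w\<close> counts the rotations that bring the
  end \<open>e\<close> of the gap to \<open>n - 2\<close>. The induction runs from the end because
  an appended letter acts on the image.\<close>
proof (induction w arbitrary: e g rule: rev_induct)
  case Nil
  have "g = 0"
  proof (rule ccontr)
    assume "g \<noteq> 0"
    then have "e \<notin> {..<n}" using Nil(4)[of 0] by simp
    then show False using Nil(2) by simp
  qed
  then show ?case by simp
next
  case (snoc a w)
  define S where "S = (\<lambda>p. the (run (cerny n) p w)) ` {..<n}"
  define S' where "S' = (\<lambda>p. the (run (cerny n) p (w @ [a]))) ` {..<n}"
  have S': "S' = (\<lambda>q. the (cerny n q a)) ` S"
  proof -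
    have "the (run (cerny n) p (w @ [a])) = the (cerny n (the (run (cerny n) p w)) a)" for p
      using cerny_run_defined[of n p w] by (auto simp: run_append cerny_def)
    then show ?thesis unfolding S_def S'_def by (auto simp: image_iff)
  qed
  define ps where "ps e i = (if i \<le> e then e - i else e + n - i)" for e i
  have IH: "n * g' \<le> length w + (if e' = n - 1 then n - 1 else n - 2 - e')"
    if "e' < n" "g' < n" "\<And>i. i < g' \<Longrightarrow> ps e' i \<notin> S" for e' g'
    using snoc.IH[of e' g'] snoc.prems(1) that by (auto simp: S_def ps_def)
  have hole: "ps e i \<notin> S'" if "i < g" for i
    using snoc.prems(4)[OF that] by (simp add: S'_def ps_def)
  have ps_n: "ps e' i < n" if "e' < n" "i < g" for e' i
    using that snoc.prems(3) by (auto simp: ps_def)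
  show ?case
  proof (cases "a = 0")
    case True
    define e' where "e' = (if e = 0 then n - 1 else e - 1)"
    have e'n: "e' < n" using n snoc.prems(2) by (auto simp: e'_def)
    have "ps e' i \<notin> S" if i: "i < g" for i
    proof
      assume *: "ps e' i \<in> S"
      have "the (cerny n (ps e' i) a) = (if ps e' i + 1 = n then 0 else ps e' i + 1)"
        using True ps_n[OF e'n i] by (auto simp: cerny_def)
      also have "\<dots> = ps e i"
        using i snoc.prems(2,3) by (auto simp: ps_def e'_def)
      finally have "ps e i \<in> S'" unfolding S' using * by (metis imageI)
      then show False using hole[OF i] by simp
    qed
    from IH[OF e'n snoc.prems(3) this]
    have "n * g \<le> length w + (if e' = n - 1 then n - 1 else n - 2 - e')" .
    then show ?thesis using n snoc.prems(2) by (auto simp: e'_def split: if_splits)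
  next
    case False
    have b: "the (cerny n q a) = (if q + 1 = n then 0 else q)" for q using False by (simp add: cerny_def)
    have keep: "j \<notin> S" if "j \<notin> S'" "j \<noteq> n - 1" for j
    proof
      assume "j \<in> S"
      then have "the (cerny n j a) \<in> S'" unfolding S' by (rule imageI)
      then show False using that b[of j] by (auto split: if_splits)
    qed
    have keep0: "n - 1 \<notin> S" if "0 \<notin> S'"
    proof
      assume "n - 1 \<in> S"
      then have "the (cerny n (n - 1) a) \<in> S'" unfolding S' by (rule imageI)
      then show False using that n by (simp add: b)
    qed
    show ?thesis
    proof (cases "e = n - 1 \<and> g \<noteq> 0")
      case True
      \<comment> \<open>The only case in which the gap grows: the letter empties
        \<open>n - 1\<close>, so before it a gap of length \<open>g - 1\<close> ended at
        \<open>n - 2\<close>.\<close>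
      have "n * (g - 1) \<le> length w + (if n - 2 = n - 1 then n - 1 else n - 2 - (n - 2))"
      proof (rule IH)
        fix i assume i: "i < g - 1"
        have "ps (n - 2) i = ps e (i + 1)" "ps e (i + 1) \<noteq> n - 1" "i + 1 < g"
          using True n i snoc.prems(3) by (auto simp: ps_def)
        then show "ps (n - 2) i \<notin> S" using keep[OF hole[of "i + 1"]] by simp
      qed (use n snoc.prems in auto)
      moreover have "n * g = n * (g - 1) + n" using True by (cases g) auto
      ultimately show ?thesis using n True by (auto split: if_splits)
    next
      case False
      have "n * g \<le> length w + (if e = n - 1 then n - 1 else n - 2 - e)"
      proof (rule IH[OF snoc.prems(2,3)])
        fix i assume i: "i < g"
        show "ps e i \<notin> S"
        proof (cases "ps e i = n - 1")
          case True
          \<comment> \<open>A gap that wraps around through \<open>n - 1\<close> contains 0, and 0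
            is missing after the letter only if \<open>n - 1\<close> was missing before.\<close>
          have "e < n - 1" using False snoc.prems(2) i by auto
          then have "e < i" "ps e e = 0" using True by (auto simp: ps_def split: if_splits)
          then have "0 \<notin> S'" using hole[of e] i by simp
          then show ?thesis using True keep0 by simp
        next
          case False
          then show ?thesis using keep hole[OF i] by simp
        qed
      qed
      then show ?thesis by simp
    qed
  qed
qed

lemma car_ge_square:
  assumes n: "2 \<le> n"
  shows "(n - 1)\<^sup>2 \<le> car n 2"
proof -
  obtain w0 where w0: "set w0 \<subseteq> {..<2}" "w0 \<noteq> []" "\<And>p. p < n \<Longrightarrow> run (cerny n) p w0 = Some 0"
    using cerny_sync[OF n] by auto
  have closed: "\<And>p a q. p \<in> {..<n} \<Longrightarrow> a < 2 \<Longrightarrow> cerny n p a = Some q \<Longrightarrow> q \<in> {..<n}"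
    using n by (auto simp: cerny_def split: if_splits)
  show ?thesis
  proof (rule car_ge[of "{..<n}" n 2 "cerny n" w0 0])
    fix w q assume sw: "set w \<subseteq> {..<2}" and r: "\<And>p. p \<in> {..<n} \<Longrightarrow> run (cerny n) p w = Some q"
    have im: "(\<lambda>p. the (run (cerny n) p w)) ` {..<n} \<subseteq> {q}" using r by auto
    \<comment> \<open>The \<open>n - 1\<close> states other than \<open>q\<close> form a gap that
      ends cyclically just before \<open>q\<close>.\<close>
    define e where "e = (if q = 0 then n - 1 else q - 1)"
    have "run (cerny n) 0 w = Some q" using r n by simp
    moreover have "0 \<in> {..<n}" using n by simp
    ultimately have "q \<in> {..<n}" using run_closed[of "{..<n}" 2 "cerny n" w 0 q] closed sw by blast
    then have qn: "q < n" by simp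
    have "n * (n - 1) \<le> length w + (if e = n - 1 then n - 1 else n - 2 - e)"
    proof (rule cerny_gap[OF n sw])
      fix i assume i: "i < n - 1"
      have "(if i \<le> e then e - i else e + n - i) \<noteq> q" unfolding e_def using qn i by auto
      then show "(if i \<le> e then e - i else e + n - i) \<notin> (\<lambda>p. the (run (cerny n) p w)) ` {..<n}"
        using im by blast
    qed (use n qn in \<open>auto simp: e_def\<close>)
    moreover have "(if e = n - 1 then n - 1 else n - 2 - e) \<le> n - 1" by auto
    ultimately have "n * (n - 1) \<le> length w + (n - 1)" by linarith
    moreover have "n * (n - 1) = (n - 1)\<^sup>2 + (n - 1)" using n by (cases n) (auto simp: power2_eq_square)
    ultimately show "(n - 1)\<^sup>2 \<le> length w" by linarith
  next
    show "\<And>p a q. p \<in> {..<n} \<Longrightarrow> a < 2 \<Longrightarrow> cerny n p a = Some q \<Longrightarrow> q \<in> {..<n}" by (rule closed)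
    show "{..<n} \<noteq> {}" using n by (auto simp: lessThan_empty_iff)
  qed (use n w0 in auto)
qed

subsection \<open>The ring automaton\<close>

text \<open>Outside positions 0 to 3 only \<open>Dig\<close>, \<open>Mark\<close> (the mark) and \<open>Idle\<close> (a token after a reset) occur. \<open>Carry\<close>
  is a digit that has overflowed, \<open>Exit\<close> and \<open>Late\<close> are the mark at positions 1 and 2 after the total letter.\<close>

datatype label = Dig nat | Mark | Late | Idle | Carry | Exit | Err

datatype state = Ring nat label | Ctl nat

text \<open>The suffixes \<open>x\<close> and \<open>y\<close> stand for the partial letter 0 and
  the total letter 1; \<open>j\<close> is the position before the move.\<close>

fun xlab :: "nat \<Rightarrow> label \<Rightarrow> label option" where
  "xlab j (Dig v) = Some (Dig v)"
| "xlab j Mark = Some Mark"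
| "xlab j Late = Some Mark"
| "xlab j Idle = Some (if j = 0 then Mark else Dig 0)"
| "xlab j Carry = Some Idle"
| "xlab j Exit = None"
| "xlab j Err = None"

fun ylab :: "nat \<Rightarrow> nat \<Rightarrow> label \<Rightarrow> label" where
  "ylab b j (Dig v) = (if j = 0 then (if v + 1 < b then Dig (v + 1) else Carry) else if j = 2 then Err else Dig v)"
| "ylab b j Mark = (if j = 0 then Exit else if j = 1 then Late else Mark)"
| "ylab b j Late = Err"
| "ylab b j Idle = Idle"
| "ylab b j Carry = Dig 0"
| "ylab b j Exit = Dig 0"
| "ylab b j Err = Idle"

text \<open>The control is one further token, on \<open>\<kappa>\<close> states of its own, that
  acts by leaving the partial letter undefined; \<open>\<kappa> = 0\<close> means no control, so
  \<open>cx\<close> must not block then. Two total letters bring it to \<open>vB\<close>, from where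
  the partial letter leads to 0. By \<open>cx4\<close> the ring can turn by multiples of four
  partial letters with the control back at 0.\<close>

locale ring =
  fixes N b \<kappa> vB :: nat and cx :: "nat \<Rightarrow> nat option" and cy :: "nat \<Rightarrow> nat"
  assumes N_odd: "odd N" and N_ge: "5 \<le> N" and b_pos: "0 < b"
    and cy_cy: "cy (cy c) = vB" and cy_0: "cy 0 = vB" and cx_vB: "cx vB = Some 0"
    and cx4: "Option.bind (Option.bind (Option.bind (cx 0) cx) cx) cx = Some 0"
    and cx_less: "c < \<kappa> \<Longrightarrow> cx c = Some c' \<Longrightarrow> c' < \<kappa>"
    and cy_less: "c < \<kappa> \<Longrightarrow> cy c < \<kappa>"
    and cx_total: "\<kappa> = 0 \<Longrightarrow> cx c \<noteq> None"
begin

definition nxt :: "nat \<Rightarrow> nat" where "nxt j = (if Suc j = N then 0 else Suc j)"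

text \<open>The slot at position \<open>j\<close> is digit number \<open>rho p j\<close> of the counter when the marker is at position \<open>p\<close>:
  going back two positions from the marker increases the number by one.\<close>

definition rho :: "nat \<Rightarrow> nat \<Rightarrow> nat" where
  "rho p j = (let d = (if j \<le> p then p - j else p + N - j) in if even d then d div 2 else (d + N) div 2)"

text \<open>Landing place of an exiting mark, chosen so that it can coincide with another token: at
  position 0 of the ring, or on the control token if there is one.\<close>

definition fin :: state where "fin = (if \<kappa> = 0 then Ring 0 (Dig 0) else Ctl 0)"

fun \<delta> :: "state \<Rightarrow> nat \<Rightarrow> state option" where
  "\<delta> (Ring j l) a = (if a = 0 then (if l = Exit then Some fin else map_option (Ring (nxt j)) (xlab j l))
     else Some (Ring (nxt j) (ylab b j l)))"
| "\<delta> (Ctl c) a = (if a = 0 then map_option Ctl (cx c) else Some (Ctl (cy c)))"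

text \<open>The four exceptional labels are confined to one position each, so they add only four
  states to the \<open>(b + 2) * N\<close> ordinary ones.\<close>

definition valid :: "nat \<Rightarrow> label \<Rightarrow> bool" where
  "valid j l \<longleftrightarrow> j < N \<and> (case l of Dig v \<Rightarrow> v < b | Mark \<Rightarrow> True | Idle \<Rightarrow> True
     | Late \<Rightarrow> j = 2 | Carry \<Rightarrow> j = 1 | Exit \<Rightarrow> j = 1 | Err \<Rightarrow> j = 3)"

definition States :: "state set" where
  "States = {Ring j l | j l. valid j l} \<union> Ctl ` {..<\<kappa>}"

section \<open>Arithmetic of positions and digit numbers\<close>

lemma nxt_less: "j < N \<Longrightarrow> nxt j < N" by (auto simp: nxt_def)

lemma nxt_mod: "j < N \<Longrightarrow> nxt j = (j + 1) mod N" by (auto simp: nxt_def)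

lemma nxt_surj: "i < N \<Longrightarrow> \<exists>j<N. nxt j = i"
  by (rule exI[of _ "if i = 0 then N - 1 else i - 1"]) (auto simp: nxt_def)

lemma rho_nxt: "p < N \<Longrightarrow> j < N \<Longrightarrow> rho (nxt p) (nxt j) = rho p j"
  using N_odd unfolding rho_def nxt_def Let_def by (auto; presburger)

lemma rho_less: "p < N \<Longrightarrow> j < N \<Longrightarrow> rho p j < N"
  using N_odd unfolding rho_def Let_def by (auto; presburger)

lemma rho_0_iff: "p < N \<Longrightarrow> j < N \<Longrightarrow> rho p j = 0 \<longleftrightarrow> j = p"
  using N_odd unfolding rho_def Let_def by (auto; presburger)

text \<open>The case distinction in \<open>rho\<close> amounts to halving \<open>p - j\<close>
  modulo the odd number \<open>N\<close>; this congruence replaces it from here on.\<close>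

lemma rho_char:
  assumes "p < N" "j < N"
  shows "\<exists>k. 2 * rho p j + j = p + k * N"
proof -
  define d where "d = (if j \<le> p then p - j else p + N - j)"
  have d: "d + j = p \<or> d + j = p + N" using assms by (auto simp: d_def)
  have r: "rho p j = (if even d then d div 2 else (d + N) div 2)" by (simp add: rho_def d_def Let_def)
  have "2 * rho p j = d \<or> 2 * rho p j = d + N" using N_odd r by (auto split: if_splits)
  then have "2 * rho p j + j = p + 0 * N \<or> 2 * rho p j + j = p + 1 * N \<or> 2 * rho p j + j = p + 2 * N"
    using d by auto
  then show ?thesis by blast
qed

lemma rho_inj:
  assumes "p < N" "i < N" "j < N" "rho p i = rho p j"
  shows "i = j"
proof -
  obtain k l where "2 * rho p i + i = p + k * N" "2 * rho p j + j = p + l * N"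
    using rho_char assms by meson
  then have "i + l * N = j + k * N" using assms(4) by linarith
  then have "(i + l * N) mod N = (j + k * N) mod N" by simp
  then show ?thesis using assms by simp
qed

lemma rho_eqI:
  assumes "p < N" "j < N" "r < N" "2 * r + j = p + k * N"
  shows "rho p j = r"
proof -
  obtain l where l: "2 * rho p j + j = p + l * N" using rho_char assms by blast
  have lt: "rho p j < N" using rho_less assms by simp
  have "int N dvd 2 * (int r - int (rho p j))"
  proof
    show "2 * (int r - int (rho p j)) = int N * (int k - int l)"
      using arg_cong[OF assms(4), of int] arg_cong[OF l, of int] by (simp add: algebra_simps)
  qed
  moreover have "coprime (int N) 2" using N_odd by simp
  ultimately have "int N dvd int r - int (rho p j)" using coprime_dvd_mult_right_iff by blast
  then have "int r mod int N = int (rho p j) mod int N" by (simp add: mod_eq_dvd_iff)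
  then show ?thesis using lt assms(3) by simp
qed

text \<open>Two positions back means one digit up: whenever position 0 holds a digit other than the
  lowest, the digit just below it stands at position 2. So the total letter sees at position 2
  whether a carry into position 0 is due.\<close>

lemma rho_pred:
  assumes p: "p < N" "p \<noteq> 0" "p \<noteq> 2"
  shows "rho p 0 = Suc (rho p 2)"
proof -
  obtain k where k: "2 * rho p 2 + 2 = p + k * N" using rho_char[of p 2] p N_ge by auto
  have "rho p 2 \<noteq> N - 1"
  proof
    assume "rho p 2 = N - 1"
    then have "p + k * N = 2 * N" using k N_ge by simp
    then have "(p + k * N) mod N = 0" by simp
    then show False using p by simp
  qed
  then have "Suc (rho p 2) < N" using rho_less[of p 2] p N_ge by simp
  then show ?thesis using k p N_ge by (intro rho_eqI[where k = k]) auto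
qed

lemma rho_20: "rho 2 0 = 1"
  using N_ge by (intro rho_eqI[where k = 0]) auto

lemma rho_02: "rho 0 2 = N - 1"
  using N_ge by (intro rho_eqI[where k = 2]) auto

lemma rho_2_eq:
  assumes p: "p < N"
  shows "rho p 2 = r \<longleftrightarrow> r < N \<and> p = (2 + 2 * r) mod N"
proof
  assume r: "rho p 2 = r"
  obtain k where "2 * rho p 2 + 2 = p + k * N" using rho_char[of p 2] p N_ge by auto
  then show "r < N \<and> p = (2 + 2 * r) mod N" using rho_less[of p 2] r p N_ge by (auto simp: add.commute[of 2])
next
  assume r: "r < N \<and> p = (2 + 2 * r) mod N"
  have "2 + 2 * r = (2 + 2 * r) mod N + (2 + 2 * r) div N * N" by (rule mod_div_mult_eq[symmetric])
  then have "2 * r + 2 = p + (2 + 2 * r) div N * N" using r by linarith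
  then show "rho p 2 = r" by (rule rho_eqI[rotated 3]) (use r p N_ge in auto)
qed

lemma nxt_simps [simp]: "nxt 0 = 1" "nxt 1 = 2" "nxt (Suc 0) = 2" "nxt 2 = 3" "nxt 3 = 4"
  using N_ge by (auto simp: nxt_def)

lemma nxt_eq_1: "j < N \<Longrightarrow> nxt j = 1 \<longleftrightarrow> j = 0" and nxt_eq_2: "j < N \<Longrightarrow> nxt j = 2 \<longleftrightarrow> j = 1"
  and nxt_eq_3: "j < N \<Longrightarrow> nxt j = 3 \<longleftrightarrow> j = 2"
  using N_ge by (auto simp: nxt_def)

lemma valid_x: "valid j l \<Longrightarrow> xlab j l = Some l' \<Longrightarrow> valid (nxt j) l'"
  using b_pos nxt_less[of j] by (cases l) (auto simp: valid_def split: if_splits)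

lemma valid_y: "valid j l \<Longrightarrow> valid (nxt j) (ylab b j l)"
  using b_pos nxt_less[of j] by (cases l) (auto simp: valid_def)

lemma \<delta>_closed: "s \<in> States \<Longrightarrow> \<delta> s a = Some s' \<Longrightarrow> s' \<in> States"
  using valid_x valid_y cx_less cy_less b_pos N_ge
  by (cases s) (auto simp: States_def fin_def valid_def[of 0] split: if_splits)

lemma finite_States: "finite States" and card_States: "card States \<le> (b + 2) * N + 4 + \<kappa>"
proof -
  define L where "L = insert Mark (insert Idle (Dig ` {..<b}))"
  define E where "E = {Ring 1 Carry, Ring 1 Exit, Ring 3 Err, Ring 2 Late}"
  define U where "U = (\<lambda>(j, l). Ring j l) ` ({..<N} \<times> L) \<union> E \<union> Ctl ` {..<\<kappa>}"
  have sub: "States \<subseteq> U"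
  proof
    fix s assume "s \<in> States"
    then consider j l where "s = Ring j l" "valid j l" | "s \<in> Ctl ` {..<\<kappa>}" by (auto simp: States_def)
    then show "s \<in> U"
    proof cases
      case 1
      then show ?thesis by (cases l) (auto simp: U_def E_def L_def valid_def image_iff)
    qed (auto simp: U_def)
  qed
  have fL: "finite L" by (simp add: L_def)
  have fU: "finite U" by (simp add: U_def E_def fL)
  show "finite States" using finite_subset[OF sub fU] .
  have "card L \<le> b + 2" unfolding L_def
    by (rule order_trans[OF card_insert_le_m1]) (auto intro!: order_trans[OF card_insert_le_m1] card_image_le[THEN order_trans])
  then have "card L * N \<le> (b + 2) * N" by (rule mult_le_mono1)
  then have "card ({..<N} \<times> L) \<le> (b + 2) * N" by (simp add: card_cartesian_product mult.commute)
  moreover have "card ((\<lambda>(j, l). Ring j l) ` ({..<N} \<times> L)) \<le> card ({..<N} \<times> L)"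
    by (intro card_image_le) (simp add: fL)
  moreover have "card E \<le> 4" unfolding E_def
    by (intro order_trans[OF card_insert_le_m1]) auto
  moreover have "card (Ctl ` {..<\<kappa>}) \<le> \<kappa>" using card_image_le[of "{..<\<kappa>}" Ctl] by simp
  moreover have "card U \<le> card ((\<lambda>(j, l). Ring j l) ` ({..<N} \<times> L)) + card E + card (Ctl ` {..<\<kappa>})"
    unfolding U_def by (meson add_le_mono card_Un_le order.trans order_refl)
  moreover have "card States \<le> card U" by (rule card_mono[OF fU sub])
  ultimately show "card States \<le> (b + 2) * N + 4 + \<kappa>" by linarith
qed

section \<open>Counter configurations and the action of the letters on them\<close>

definition Tok :: "(nat \<Rightarrow> label) \<Rightarrow> nat \<Rightarrow> state set" where
  "Tok f c = (\<lambda>j. Ring j (f j)) ` {..<N} \<union> (if \<kappa> = 0 then {} else {Ctl c})"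

text \<open>Configuration after a partial letter, with marker at \<open>p\<close> and digits
  \<open>e\<close>. The value \<open>b\<close> encodes an overflowed digit whose carry is still
  pending; it appears as \<open>Idle\<close>, which the total letter tolerates at position
  2.\<close>

definition mkx :: "nat \<Rightarrow> (nat \<Rightarrow> nat) \<Rightarrow> nat \<Rightarrow> label" where
  "mkx p e j = (let r = rho p j in if r = 0 then Mark else if e r = b then Idle else Dig (e r))"

text \<open>Configuration after a total letter. Position 3 then holds the mark or a token that
  passed position 2 as \<open>Idle\<close>; a new overflow stands at position 1.\<close>

definition mky :: "nat \<Rightarrow> (nat \<Rightarrow> nat) \<Rightarrow> nat \<Rightarrow> label" where
  "mky p e j = (let r = rho p j in
     if r = 0 then (if p = 1 then Exit else if p = 2 then Late else Mark)
     else if j = 3 then Idle else if e r = b then Carry else Dig (e r))"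

definition okx :: "nat \<Rightarrow> (nat \<Rightarrow> nat) \<Rightarrow> bool" where
  "okx p e \<longleftrightarrow> p < N \<and> (\<forall>r. 0 < r \<longrightarrow> r < N \<longrightarrow> e r \<le> b \<and> (e r = b \<longrightarrow> r = rho p 2))"

definition oky :: "nat \<Rightarrow> (nat \<Rightarrow> nat) \<Rightarrow> bool" where
  "oky p e \<longleftrightarrow> p < N \<and> (\<forall>r. 0 < r \<longrightarrow> r < N \<longrightarrow> e r \<le> b \<and> (e r = b \<longrightarrow> r = rho p 1) \<and> (r = rho p 3 \<longrightarrow> e r = 0))"

text \<open>A partial letter in place of the carry loses it: the overflowed digit restarts at 0 and
  the next digit is not raised.\<close>

definition drop_carry :: "(nat \<Rightarrow> nat) \<Rightarrow> nat \<Rightarrow> nat" where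
  "drop_carry e r = (if e r = b then 0 else e r)"

text \<open>Index 0 belongs to the marker and its value in \<open>e\<close> is never displayed, so
  \<open>p = 0\<close> and \<open>p = 2\<close> need no clause of their own.\<close>

definition incr :: "nat \<Rightarrow> (nat \<Rightarrow> nat) \<Rightarrow> nat \<Rightarrow> nat" where
  "incr p e r = (if r = rho p 2 then 0 else if r = rho p 0 then e r + 1 else e r)"

text \<open>The condition under which the total letter creates no \<open>Err\<close> at position
  3.\<close>

definition legal :: "nat \<Rightarrow> (nat \<Rightarrow> nat) \<Rightarrow> bool" where
  "legal p e \<longleftrightarrow> p = 2 \<or> e (rho p 2) = b"

lemma lt_N: "0 < N" "1 < N" "2 < N" "3 < N" "4 < N" using N_ge by auto

lemma okx_le: "okx p e \<Longrightarrow> r \<noteq> 0 \<Longrightarrow> r < N \<Longrightarrow> e r \<le> b"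
  and okx_carry: "okx p e \<Longrightarrow> r \<noteq> 0 \<Longrightarrow> r < N \<Longrightarrow> e r = b \<Longrightarrow> r = rho p 2"
  by (auto simp: okx_def)

lemma mkx_x:
  assumes ok: "okx p e" and j: "j < N"
  shows "mkx p e j \<noteq> Exit" "xlab j (mkx p e j) = Some (mkx (nxt p) (drop_carry e) (nxt j))"
proof -
  have p: "p < N" using ok unfolding okx_def by blast
  show "mkx p e j \<noteq> Exit" by (auto simp: mkx_def Let_def)
  have eq: "rho (nxt p) (nxt j) = rho p j" by (rule rho_nxt[OF p j])
  show "xlab j (mkx p e j) = Some (mkx (nxt p) (drop_carry e) (nxt j))"
  proof (cases "rho p j \<noteq> 0 \<and> e (rho p j) = b")
    case True
    then have "rho p j = rho p 2" using okx_carry[OF ok] rho_less[OF p j] by blast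
    then have "j = 2" by (rule rho_inj[OF p j lt_N(3)])
    then show ?thesis using True eq b_pos by (simp add: mkx_def Let_def drop_carry_def)
  next
    case False
    then show ?thesis unfolding mkx_def Let_def drop_carry_def eq by auto
  qed
qed

lemma okx_x: "okx p e \<Longrightarrow> okx (nxt p) (drop_carry e)"
  using nxt_less b_pos by (auto simp: okx_def drop_carry_def)

lemma mkx_y:
  assumes ok: "okx p e" and leg: "legal p e" and j: "j < N"
  shows "ylab b j (mkx p e j) = mky (nxt p) (incr p e) (nxt j)"
proof -
  have p: "p < N" using ok unfolding okx_def by blast
  have eq: "rho (nxt p) (nxt j) = rho p j" by (rule rho_nxt[OF p j])
  have z: "rho p j = 0 \<longleftrightarrow> j = p" using rho_0_iff[OF p j] .
  show ?thesis
  proof (cases "j = p")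
    case True
    then show ?thesis using z eq nxt_eq_1[OF p] nxt_eq_2[OF p]
      by (simp add: mkx_def mky_def Let_def)
  next
    case jp: False
    then have z': "rho p j \<noteq> 0" using z by simp
    have le: "e (rho p j) \<le> b" using okx_le[OF ok] rho_less[OF p j] z' by blast
    have i2: "rho p j = rho p 2 \<longleftrightarrow> j = 2" using rho_inj[OF p j lt_N(3)] by blast
    have i0: "rho p j = rho p 0 \<longleftrightarrow> j = 0" using rho_inj[OF p j lt_N(1)] by blast
    have b2: "e (rho p j) = b \<longleftrightarrow> j = 2"
    proof
      assume "e (rho p j) = b"
      then show "j = 2" using okx_carry[OF ok _ rho_less[OF p j]] z' i2 by blast
    next
      assume "j = 2"
      then show "e (rho p j) = b" using leg jp by (auto simp: legal_def)
    qed
    have L: "mkx p e j = (if j = 2 then Idle else Dig (e (rho p j)))"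
      using z' b2 by (simp add: mkx_def Let_def)
    have R: "mky (nxt p) (incr p e) (nxt j) = (if j = 2 then Idle else
        if incr p e (rho p j) = b then Carry else Dig (incr p e (rho p j)))"
      unfolding mky_def Let_def eq using z' nxt_eq_3[OF j] by simp
    show ?thesis unfolding L R incr_def i2 i0 using b2 le by auto
  qed
qed

lemma oky_y:
  assumes ok: "okx p e" and leg: "legal p e"
  shows "oky (nxt p) (incr p e)"
proof -
  have p: "p < N" using ok unfolding okx_def by blast
  have r: "rho (nxt p) 1 = rho p 0" "rho (nxt p) 3 = rho p 2"
    using rho_nxt[OF p lt_N(1)] rho_nxt[OF p lt_N(3)] by auto
  have ne: "rho p 0 \<noteq> rho p 2" using rho_inj[OF p lt_N(1) lt_N(3)] by (metis zero_neq_numeral)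
  have lt: "e t < b" if "t \<noteq> 0" "t < N" "t \<noteq> rho p 2" for t
    using okx_le[OF ok that(1,2)] okx_carry[OF ok that(1,2)] that(3) by (meson le_neq_implies_less)
  show ?thesis
    unfolding oky_def r
  proof (intro conjI allI impI)
    fix t assume t: "0 < t" "t < N"
    show "incr p e t \<le> b" using lt[of t] t
      by (cases "t = rho p 2"; cases "t = rho p 0") (simp_all add: incr_def less_imp_le Suc_le_eq)
    show "t = rho p 0" if "incr p e t = b"
      using that lt[of t] t b_pos by (simp add: incr_def split: if_splits)
    show "incr p e t = 0" if "t = rho p 2" using that by (simp add: incr_def)
  qed (rule nxt_less[OF p])
qed

lemma oky_le: "oky p e \<Longrightarrow> r \<noteq> 0 \<Longrightarrow> r < N \<Longrightarrow> e r \<le> b"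
  and oky_carry: "oky p e \<Longrightarrow> r \<noteq> 0 \<Longrightarrow> r < N \<Longrightarrow> e r = b \<Longrightarrow> r = rho p 1"
  and oky_0: "oky p e \<Longrightarrow> r \<noteq> 0 \<Longrightarrow> r < N \<Longrightarrow> r = rho p 3 \<Longrightarrow> e r = 0"
  by (auto simp: oky_def)

lemma mky_x:
  assumes ok: "oky p e" and j: "j < N" and ex: "\<not> (p = 1 \<and> j = 1)"
  shows "mky p e j \<noteq> Exit" "xlab j (mky p e j) = Some (mkx (nxt p) e (nxt j))"
proof -
  have p: "p < N" using ok unfolding oky_def by blast
  have eq: "rho (nxt p) (nxt j) = rho p j" by (rule rho_nxt[OF p j])
  have z: "rho p j = 0 \<longleftrightarrow> j = p" using rho_0_iff[OF p j] .
  show "mky p e j \<noteq> Exit" using ex z by (simp add: mky_def Let_def)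
  show "xlab j (mky p e j) = Some (mkx (nxt p) e (nxt j))"
  proof (cases "rho p j = 0")
    case True
    then show ?thesis using ex z eq by (simp add: mkx_def mky_def Let_def)
  next
    case False
    have "e (rho p j) = 0" if "j = 3" 
      by (rule oky_0[OF ok False rho_less[OF p j]]) (simp add: that)
    then show ?thesis unfolding mkx_def mky_def Let_def eq using False b_pos by simp
  qed
qed

lemma okx_y:
  assumes ok: "oky p e"
  shows "okx (nxt p) e"
proof -
  have p: "p < N" using ok unfolding oky_def by blast
  have r: "rho (nxt p) 2 = rho p 1" using rho_nxt[OF p lt_N(2)] by simp
  show ?thesis unfolding okx_def r
    using nxt_less[OF p] oky_le[OF ok] oky_carry[OF ok] by blast
qed

text \<open>Moving on by one permutes the positions, so a full configuration stays full and no two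
  tokens merge.\<close>

lemma Tok_x:
  assumes "\<And>j. j < N \<Longrightarrow> f j \<noteq> Exit" "\<And>j. j < N \<Longrightarrow> xlab j (f j) = Some (g (nxt j))" "cx c = Some c'"
  shows "(\<lambda>s. \<delta> s 0) ` Tok f c = Some ` Tok g c'"
proof -
  have im: "nxt ` {..<N} = {..<N}"
    using nxt_less nxt_surj by (auto simp: image_iff)
  have "(\<lambda>s. \<delta> s 0) ` (\<lambda>j. Ring j (f j)) ` {..<N} = (\<lambda>j. Some (Ring (nxt j) (g (nxt j)))) ` {..<N}"
    unfolding image_image by (rule image_cong) (auto simp: assms)
  also have "\<dots> = Some ` (\<lambda>j. Ring j (g j)) ` nxt ` {..<N}" by (simp add: image_image)
  finally show ?thesis using assms(3) unfolding im by (simp add: Tok_def image_Un)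
qed

lemma Tok_y:
  assumes "\<And>j. j < N \<Longrightarrow> ylab b j (f j) = g (nxt j)"
  shows "(\<lambda>s. \<delta> s (Suc a)) ` Tok f c = Some ` Tok g (cy c)"
proof -
  have im: "nxt ` {..<N} = {..<N}"
    using nxt_less nxt_surj by (auto simp: image_iff)
  have "(\<lambda>s. \<delta> s (Suc a)) ` (\<lambda>j. Ring j (f j)) ` {..<N} = (\<lambda>j. Some (Ring (nxt j) (g (nxt j)))) ` {..<N}"
    unfolding image_image by (rule image_cong) (auto simp: assms)
  also have "\<dots> = Some ` (\<lambda>j. Ring j (g j)) ` nxt ` {..<N}" by (simp add: image_image)
  finally show ?thesis unfolding im by (simp add: Tok_def image_Un)
qed

lemma mkx_0: "p < N \<Longrightarrow> mkx p (\<lambda>_. 0) j = (if rho p j = 0 then Mark else Dig 0)"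
  using b_pos by (simp add: mkx_def Let_def)

text \<open>Only the token at position 0 becomes the mark, and it moves on with this letter; hence a
  fresh counter has its marker at position 1.\<close>

lemma idle_x: "j < N \<Longrightarrow> xlab j Idle = Some (mkx 1 (\<lambda>_. 0) (nxt j))"
  using rho_0_iff[of 1 "nxt j"] nxt_less[of j] nxt_eq_1[of j] lt_N(2) by (auto simp: mkx_0)

subsection \<open>Lower bound\<close>

definition syncs :: "state set \<Rightarrow> nat list \<Rightarrow> bool" where
  "syncs T w \<longleftrightarrow> (\<exists>q. \<forall>s\<in>T. run \<delta> s w = Some q)"

lemma syncs_Cons:
  assumes "syncs T (a # w)" "(\<lambda>s. \<delta> s a) ` T = Some ` T'"
  shows "syncs T' w"
proof -
  obtain q where q: "\<forall>s\<in>T. run \<delta> s (a # w) = Some q" using assms(1) by (auto simp: syncs_def)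
  have "run \<delta> s' w = Some q" if "s' \<in> T'" for s'
  proof -
    have "Some s' \<in> (\<lambda>s. \<delta> s a) ` T" using that assms(2) by simp
    then obtain s where "s \<in> T" "\<delta> s a = Some s'" by auto
    then show ?thesis using q by force
  qed
  then show ?thesis by (auto simp: syncs_def)
qed

lemma syncs_defined: "syncs T (a # w) \<Longrightarrow> s \<in> T \<Longrightarrow> \<delta> s a \<noteq> None"
  by (cases "\<delta> s a") (auto simp: syncs_def)

lemma Tok_not_syncs_Nil: "\<not> syncs (Tok f c) []"
proof
  assume "syncs (Tok f c) []"
  moreover have "Ring 0 (f 0) \<in> Tok f c" "Ring 1 (f 1) \<in> Tok f c" using lt_N by (auto simp: Tok_def)
  ultimately show False unfolding syncs_def by (metis option.inject run.simps(1) state.inject(1) zero_neq_one)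
qed

lemma Tok_defined_x: "syncs (Tok f c) (0 # w) \<Longrightarrow> cx c \<noteq> None"
  using syncs_defined[of "Tok f c" 0 w "Ctl c"] cx_total by (cases "\<kappa> = 0") (auto simp: Tok_def)

text \<open>\<open>spoilt q f\<close>: an \<open>Err\<close> at position 3 forbids the partial letter, and the last \<open>q\<close> slots have
  been reset already; the total letter continues the reset until all slots are \<open>Idle\<close>.\<close>

definition off :: "nat \<Rightarrow> nat" where "off j = (if 3 \<le> j then j - 3 else j + N - 3)"

text \<open>Labels not yet reset: under the total letter they stay live up to position 2 and turn
  into \<open>Err\<close> there. A \<open>Mark\<close> at position 2 is excluded because it survives
  that letter.\<close>

definition live :: "nat \<Rightarrow> label \<Rightarrow> bool" where
  "live j l = (case l of Dig v \<Rightarrow> True | Mark \<Rightarrow> j \<noteq> 2 | Late \<Rightarrow> j = 2 | Carry \<Rightarrow> j = 1 | Exit \<Rightarrow> j = 1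
     | Idle \<Rightarrow> False | Err \<Rightarrow> False)"

definition spoilt :: "nat \<Rightarrow> (nat \<Rightarrow> label) \<Rightarrow> bool" where
  "spoilt q f \<longleftrightarrow> (\<forall>j<N. if j = 3 then f j = Err else if off j < q then f j = Idle else live j (f j))"

definition prv :: "nat \<Rightarrow> nat" where "prv i = (if i = 0 then N - 1 else i - 1)"

lemma prv_nxt: "j < N \<Longrightarrow> prv (nxt j) = j"
  by (auto simp: prv_def nxt_def)

lemma off_nxt: "j < N \<Longrightarrow> off (nxt j) = (if j = 2 then 0 else Suc (off j))"
  using N_ge by (auto simp: off_def nxt_def)

lemma live_y: "j < N \<Longrightarrow> j \<noteq> 2 \<Longrightarrow> live j l \<Longrightarrow> live (nxt j) (ylab b j l)"
  using nxt_eq_2[of j] by (cases l) (auto simp: live_def)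

lemma live_2: "live 2 l \<Longrightarrow> ylab b 2 l = Err"
  by (cases l) (auto simp: live_def)

lemma all_nxt: "(\<And>j. j < N \<Longrightarrow> P (nxt j)) \<Longrightarrow> \<forall>i<N. P i"
  using nxt_surj by metis

text \<open>While \<open>q < N\<close> the token at position 2 is still live and becomes the next
  \<open>Err\<close>, as the old \<open>Err\<close> moves on and turns \<open>Idle\<close>; the
  reset sweeps backwards through the ring.\<close>

lemma spoilt_y:
  assumes f: "spoilt q f" and q: "0 < q" "q < N" and g: "\<And>j. j < N \<Longrightarrow> g (nxt j) = ylab b j (f j)"
  shows "spoilt (Suc q) g"
  unfolding spoilt_def
proof (rule all_nxt)
  fix j assume j: "j < N"
  have fj: "if j = 3 then f j = Err else if off j < q then f j = Idle else live j (f j)"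
    using f j by (simp add: spoilt_def)
  show "if nxt j = 3 then g (nxt j) = Err else if off (nxt j) < Suc q then g (nxt j) = Idle else live (nxt j) (g (nxt j))"
  proof (cases "j = 2")
    case True
    have "\<not> off 2 < q" using q by (simp add: off_def)
    then have "live 2 (f 2)" using fj unfolding True by simp
    then show ?thesis using True g[OF j] live_2 by simp
  next
    case False
    then have "off (nxt j) = Suc (off j)" "nxt j \<noteq> 3" using off_nxt[OF j] nxt_eq_3[OF j] by auto
    moreover have "off 3 = 0" by (simp add: off_def)
    ultimately show ?thesis using fj g[OF j] live_y[OF j False, of "f j"] q
      by (cases "j = 3"; cases "off j < q") simp_all
  qed
qed

lemma spoilt_end:
  assumes f: "spoilt N f" and j: "j < N"
  shows "ylab b j (f j) = Idle"
proof -
  have "off j < N" using j by (auto simp: off_def)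
  moreover have "if j = 3 then f j = Err else if off j < N then f j = Idle else live j (f j)"
    using f j by (simp add: spoilt_def)
  ultimately show ?thesis by (cases "j = 3") simp_all
qed

lemma live_mkx:
  assumes ok: "okx p e" and leg: "\<not> legal p e" and j: "j < N"
  shows "live j (mkx p e j)"
proof -
  have p: "p < N" using ok unfolding okx_def by blast
  have "e (rho p j) \<noteq> b" if "rho p j \<noteq> 0"
    using okx_carry[OF ok that rho_less[OF p j]] leg unfolding legal_def by metis
  moreover have "j \<noteq> 2" if "rho p j = 0" using rho_0_iff[OF p j] that leg unfolding legal_def by auto
  ultimately show ?thesis by (cases "rho p j = 0") (simp_all add: mkx_def Let_def live_def)
qed

lemma spoilt_mkx:
  assumes ok: "okx p e" and leg: "\<not> legal p e" and g: "\<And>j. j < N \<Longrightarrow> g (nxt j) = ylab b j (mkx p e j)"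
  shows "spoilt 1 g"
  unfolding spoilt_def
proof (rule all_nxt)
  fix j assume j: "j < N"
  show "if nxt j = 3 then g (nxt j) = Err else if off (nxt j) < 1 then g (nxt j) = Idle else live (nxt j) (g (nxt j))"
    using g[OF j] live_mkx[OF ok leg j] live_2 live_y[OF j] nxt_eq_3[OF j] off_nxt[OF j]
    by (cases "j = 2") simp_all
qed

lemma live_mky:
  assumes ok: "oky p e" and j: "j < N" "j \<noteq> 3"
  shows "live j (mky p e j)"
proof -
  have p: "p < N" using ok unfolding oky_def by blast
  have "j = 1" if "rho p j \<noteq> 0" "e (rho p j) = b"
    using oky_carry[OF ok that(1) rho_less[OF p j(1)] that(2)] rho_inj[OF p j(1) lt_N(2)] by blast
  moreover have "rho p j = 0 \<longleftrightarrow> j = p" using rho_0_iff[OF p j(1)] .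
  ultimately show ?thesis using j(2)
    by (cases "rho p j = 0"; cases "e (rho p j) = b") (simp_all add: mky_def Let_def live_def)
qed

text \<open>A second total letter in a row always spoils the counter. Two slots count as reset if
  position 3 was already \<open>Idle\<close>, but only one if the mark stood there.\<close>

lemma spoilt_mky:
  assumes ok: "oky p e" and g: "\<And>j. j < N \<Longrightarrow> g (nxt j) = ylab b j (mky p e j)"
  shows "spoilt (if p = 3 then 1 else 2) g"
  unfolding spoilt_def
proof (rule all_nxt)
  fix j assume j: "j < N"
  have p: "p < N" using ok unfolding oky_def by blast
  consider "j = 2" | "j = 3" | "j \<noteq> 2" "j \<noteq> 3" by blast
  then show "if nxt j = 3 then g (nxt j) = Err else if off (nxt j) < (if p = 3 then 1 else 2)
     then g (nxt j) = Idle else live (nxt j) (g (nxt j))"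
  proof cases
    case 1
    then show ?thesis using g[OF j] live_mky[OF ok j] live_2 by simp
  next
    case 2
    have "mky p e 3 = (if p = 3 then Mark else Idle)"
      using rho_0_iff[OF p lt_N(4)] by (auto simp: mky_def Let_def)
    then show ?thesis using g[OF j] 2 by (auto simp: off_def live_def)
  next
    case 3
    then have "off (nxt j) = Suc (off j)" "nxt j \<noteq> 3" using off_nxt[OF j] nxt_eq_3[OF j] by auto
    moreover have "off j \<noteq> 0" using 3 N_ge by (auto simp: off_def)
    ultimately show ?thesis using g[OF j] live_y[OF j 3(1) live_mky[OF ok j 3(2)]] by simp
  qed
qed

end

section \<open>Amortised lower bound on the number of letters\<close>

text \<open>\<open>wt r\<close> is the price in letters of one unit in digit \<open>r\<close>, and
  \<open>D c p\<close> is a waiting time until the next increment can start. The assumptions say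
  that each letter pays for what it changes: a partial letter, an increment of digit 1, a carry, and
  finally the exit of the mark. The conditions on \<open>c\<close> describe a total letter between
  two partial ones.\<close>

locale ring_potential = ring +
  fixes wt :: "nat \<Rightarrow> nat" and D :: "nat \<Rightarrow> nat \<Rightarrow> nat" and L :: nat
  assumes wt_0: "wt 0 = 0"
    and D_x: "p < N \<Longrightarrow> cx c = Some c' \<Longrightarrow> D c p \<le> 1 + D c' (nxt p)"
    and D_start: "c \<in> ran cx \<Longrightarrow> cx (cy c) \<noteq> None \<Longrightarrow> wt 1 + D c 2 \<le> 1 + D (cy c) 3"
    and D_carry: "c \<in> ran cx \<Longrightarrow> cx (cy c) \<noteq> None \<Longrightarrow> p < N \<Longrightarrow> p \<noteq> 0 \<Longrightarrow> p \<noteq> 2 \<Longrightarrow>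
      wt (Suc (rho p 2)) + D c p \<le> 1 + b * wt (rho p 2) + D (cy c) (nxt p)"
    and D_exit: "c \<in> ran cx \<Longrightarrow> cx (cy c) \<noteq> None \<Longrightarrow> L + D c 0 \<le> b * wt (N - 1) + D 0 1 + 2"
begin

definition W :: "(nat \<Rightarrow> nat) \<Rightarrow> nat" where "W e = (\<Sum>r<N. e r * wt r)"

lemma W_drop_carry: "W (drop_carry e) \<le> W e"
  unfolding W_def drop_carry_def by (rule sum_mono) simp

lemma W_incr:
  assumes p: "p < N"
  shows "W (incr p e) + e (rho p 2) * wt (rho p 2) = W e + wt (rho p 0)"
proof -
  have r: "rho p 2 < N" "rho p 0 < N" "rho p 2 \<noteq> rho p 0"
    using rho_less[OF p] lt_N rho_inj[OF p lt_N(3) lt_N(1)] by auto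
  have "W (incr p e) + (\<Sum>r<N. if r = rho p 2 then e r * wt r else 0) = W e + (\<Sum>r<N. if r = rho p 0 then wt r else 0)"
    unfolding W_def sum.distrib[symmetric] incr_def by (rule sum.cong) (use r in auto)
  then show ?thesis using r by simp
qed

lemma W_ge: "r < N \<Longrightarrow> e r * wt r \<le> W e"
  unfolding W_def by (rule member_le_sum) auto

text \<open>All configurations met before \<open>L\<close> letters are spent. After a total letter
  the bound is needed only if the control permits a partial letter, since otherwise the next letter
  spoils the counter. With \<open>p = 1\<close> the mark is about to exit, so the bound is already
  \<open>L\<close> up to the coming letter.\<close>

inductive Inv :: "nat \<Rightarrow> state set \<Rightarrow> bool" where
  Inv_x: "okx p e \<Longrightarrow> c \<in> ran cx \<Longrightarrow> W e + D 0 1 \<le> t + D c p \<Longrightarrow> Inv t (Tok (mkx p e) c)"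
| Inv_y: "oky p e \<Longrightarrow> (cx c \<noteq> None \<Longrightarrow> if p = 1 then L \<le> t + 1 else W e + D 0 1 \<le> t + D c p) \<Longrightarrow>
    c = cy c' \<Longrightarrow> Inv t (Tok (mky p e) c)"
| Inv_spoilt: "spoilt q f \<Longrightarrow> 0 < q \<Longrightarrow> q \<le> N \<Longrightarrow> c = cy c' \<Longrightarrow> (1 < q \<Longrightarrow> c = vB) \<Longrightarrow> Inv t (Tok f c)"
| Inv_idle: "Inv t (Tok (\<lambda>_. Idle) vB)"

lemma Inv_step_y:
  assumes "Inv t T"
  shows "\<exists>T'. (\<lambda>s. \<delta> s (Suc a)) ` T = Some ` T' \<and> Inv (Suc t) T'"
  using assms
proof cases
  case (Inv_x p e c)
  have p: "p < N" using Inv_x(2) unfolding okx_def by blast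
  show ?thesis
  proof (cases "legal p e")
    case True
    have "(\<lambda>s. \<delta> s (Suc a)) ` T = Some ` Tok (mky (nxt p) (incr p e)) (cy c)"
      unfolding Inv_x(1) by (rule Tok_y) (rule mkx_y[OF Inv_x(2) True])
    moreover have "Inv (Suc t) (Tok (mky (nxt p) (incr p e)) (cy c))"
    proof (rule Inv.Inv_y[OF oky_y[OF Inv_x(2) True] _ refl])
      assume def: "cx (cy c) \<noteq> None"
      have Wi: "W (incr p e) + e (rho p 2) * wt (rho p 2) = W e + wt (rho p 0)" by (rule W_incr[OF p])
      consider "p = 0" | "p = 2" | "p \<noteq> 0" "p \<noteq> 2" by blast
      then show "if nxt p = 1 then L \<le> Suc t + 1 else W (incr p e) + D 0 1 \<le> Suc t + D (cy c) (nxt p)"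
      proof cases
        case 1
        \<comment> \<open>The mark may exit only while the last digit overflows, which puts
          \<open>b\<close> units of that digit into \<open>W e\<close>.\<close>
        then have "e (N - 1) = b" using True rho_02 by (simp add: legal_def)
        then have "b * wt (N - 1) \<le> W e" using W_ge[of "N - 1" e] lt_N by simp
        then have "L \<le> t + 2" using D_exit[OF Inv_x(3) def] Inv_x(4) 1 by simp
        then show ?thesis using 1 by simp
      next
        case 2
        have "rho 2 2 = 0" using rho_0_iff lt_N by simp
        then have "W (incr p e) = W e + wt 1" using Wi 2 wt_0 rho_20 by simp
        then show ?thesis using 2 D_start[OF Inv_x(3) def] Inv_x(4) by simp
      next
        case 3
        then have "e (rho p 2) = b" using True by (simp add: legal_def)
        then have "W (incr p e) + b * wt (rho p 2) = W e + wt (Suc (rho p 2))"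
          using Wi rho_pred[OF p 3] by simp
        then show ?thesis using D_carry[OF Inv_x(3) def p 3] Inv_x(4) nxt_eq_1[OF p] 3 by simp
      qed
    qed
    ultimately show ?thesis by blast
  next
    case False
    define g where "g i = ylab b (prv i) (mkx p e (prv i))" for i
    have g: "g (nxt j) = ylab b j (mkx p e j)" if "j < N" for j using prv_nxt[OF that] by (simp add: g_def)
    have "(\<lambda>s. \<delta> s (Suc a)) ` T = Some ` Tok g (cy c)"
      unfolding Inv_x(1) by (rule Tok_y) (simp add: g)
    moreover have "Inv (Suc t) (Tok g (cy c))"
      by (rule Inv.Inv_spoilt[OF spoilt_mkx[OF Inv_x(2) False g] _ _ refl]) (use lt_N in auto)
    ultimately show ?thesis by blast
  qed
next
  case (Inv_y p e c c')
  define g where "g i = ylab b (prv i) (mky p e (prv i))" for i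
  have g: "g (nxt j) = ylab b j (mky p e j)" if "j < N" for j using prv_nxt[OF that] by (simp add: g_def)
  have "(\<lambda>s. \<delta> s (Suc a)) ` T = Some ` Tok g (cy c)"
    unfolding Inv_y(1) by (rule Tok_y) (simp add: g)
  moreover have "Inv (Suc t) (Tok g (cy c))"
    by (rule Inv.Inv_spoilt[OF spoilt_mky[OF Inv_y(2) g] _ _ refl]) (use lt_N cy_cy Inv_y(4) in auto)
  ultimately show ?thesis by blast
next
  case (Inv_spoilt q f c c')
  have cB: "cy c = vB" using cy_cy Inv_spoilt(5) by simp
  show ?thesis
  proof (cases "q = N")
    case True
    have "(\<lambda>s. \<delta> s (Suc a)) ` T = Some ` Tok (\<lambda>_. Idle) (cy c)"
      unfolding Inv_spoilt(1) by (rule Tok_y) (rule spoilt_end[OF Inv_spoilt(2)[unfolded True]])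
    then show ?thesis unfolding cB using Inv_idle by blast
  next
    case False
    define g where "g i = ylab b (prv i) (f (prv i))" for i
    have g: "g (nxt j) = ylab b j (f j)" if "j < N" for j using prv_nxt[OF that] by (simp add: g_def)
    have q: "q < N" using False Inv_spoilt(4) by simp
    have "(\<lambda>s. \<delta> s (Suc a)) ` T = Some ` Tok g (cy c)"
      unfolding Inv_spoilt(1) by (rule Tok_y) (simp add: g)
    moreover have "Inv (Suc t) (Tok g (cy c))"
      by (rule Inv.Inv_spoilt[OF spoilt_y[OF Inv_spoilt(2,3) q g] _ _ refl]) (use q cB in auto)
    ultimately show ?thesis by blast
  qed
next
  case Inv_idle
  have "cy vB = vB" using cy_cy by metis
  have "(\<lambda>s. \<delta> s (Suc a)) ` T = Some ` Tok (\<lambda>_. Idle) (cy vB)"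
    unfolding Inv_idle by (rule Tok_y) simp
  then show ?thesis unfolding \<open>cy vB = vB\<close> using Inv.Inv_idle by blast
qed

lemma Inv_step_x:
  assumes "Inv t T" and sy: "syncs T (0 # w)"
  shows "L \<le> Suc t \<or> (\<exists>T'. (\<lambda>s. \<delta> s 0) ` T = Some ` T' \<and> Inv (Suc t) T')"
  using assms(1)
proof cases
  case (Inv_x p e c)
  have p: "p < N" using Inv_x(2) unfolding okx_def by blast
  obtain c' where c': "cx c = Some c'" using Tok_defined_x sy unfolding Inv_x(1) by blast
  have "(\<lambda>s. \<delta> s 0) ` T = Some ` Tok (mkx (nxt p) (drop_carry e)) c'"
    unfolding Inv_x(1) by (rule Tok_x[OF mkx_x[OF Inv_x(2)] c'])
  moreover have "Inv (Suc t) (Tok (mkx (nxt p) (drop_carry e)) c')"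
    using Inv_x(4) D_x[OF p c'] W_drop_carry[of e] c'
    by (intro Inv.Inv_x okx_x[OF Inv_x(2)]) (auto simp: ran_def)
  ultimately show ?thesis by blast
next
  case (Inv_y p e c)
  have p: "p < N" using Inv_y(2) unfolding oky_def by blast
  obtain c' where c': "cx c = Some c'" using Tok_defined_x sy unfolding Inv_y(1) by blast
  show ?thesis
  proof (cases "p = 1")
    case True
    \<comment> \<open>This letter releases \<open>Exit\<close> and tokens may merge from now on, but
      \<open>L\<close> letters have been read.\<close>
    then show ?thesis using Inv_y(3) c' by simp
  next
    case False
    have "(\<lambda>s. \<delta> s 0) ` T = Some ` Tok (mkx (nxt p) e) c'"
      unfolding Inv_y(1) by (rule Tok_x[OF mky_x[OF Inv_y(2)] c']) (use False in auto)
    moreover have "Inv (Suc t) (Tok (mkx (nxt p) e) c')"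
      using Inv_y(3) D_x[OF p c'] c' False
      by (intro Inv.Inv_x okx_y[OF Inv_y(2)]) (auto simp: ran_def)
    ultimately show ?thesis by blast
  qed
next
  case (Inv_spoilt q f c)
  have "f 3 = Err" using Inv_spoilt(2) lt_N by (simp add: spoilt_def)
  then have "Ring 3 Err \<in> T" using lt_N(4) unfolding Inv_spoilt(1) Tok_def by force
  from syncs_defined[OF sy this] show ?thesis by simp
next
  case Inv_idle
  have "(\<lambda>s. \<delta> s 0) ` T = Some ` Tok (mkx 1 (\<lambda>_. 0)) 0"
    unfolding Inv_idle by (rule Tok_x[OF _ idle_x cx_vB]) simp
  moreover have "Inv (Suc t) (Tok (mkx 1 (\<lambda>_. 0)) 0)"
  proof (rule Inv.Inv_x)
    show "okx 1 (\<lambda>_. 0)" using lt_N b_pos by (simp add: okx_def)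
    show "0 \<in> ran cx" using cx_vB by (auto simp: ran_def)
  qed (simp add: W_def)
  ultimately show ?thesis by blast
qed

lemma Inv_length: "Inv t T \<Longrightarrow> syncs T w \<Longrightarrow> L \<le> t + length w"
proof (induction w arbitrary: t T)
  case Nil
  then show ?case using Tok_not_syncs_Nil by (auto elim!: Inv.cases)
next
  case (Cons a w)
  have "L \<le> Suc t \<or> (\<exists>T'. (\<lambda>s. \<delta> s a) ` T = Some ` T' \<and> Inv (Suc t) T')"
    using Inv_step_x[OF Cons.prems(1), of w] Inv_step_y[OF Cons.prems(1), of "a - 1"] Cons.prems(2)
    by (cases a) auto
  then show ?case
  proof
    assume "\<exists>T'. (\<lambda>s. \<delta> s a) ` T = Some ` T' \<and> Inv (Suc t) T'"
    then obtain T' where T': "(\<lambda>s. \<delta> s a) ` T = Some ` T'" "Inv (Suc t) T'" by blast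
    from Cons.IH[OF T'(2) syncs_Cons[OF Cons.prems(2) T'(1)]] show ?thesis by simp
  qed simp
qed

text \<open>The configuration with all tokens \<open>Idle\<close> and control \<open>vB\<close> lies
  inside the state set, so a synchronising word must synchronise it too.\<close>

lemma sync_length:
  assumes "\<And>s. s \<in> States \<Longrightarrow> run \<delta> s w = Some q"
  shows "L \<le> length w"
proof -
  have vB: "0 < \<kappa> \<Longrightarrow> vB < \<kappa>" using cy_less[of 0] cy_0 by simp
  have "valid j Idle" if "j < N" for j using that by (simp add: valid_def)
  then have "Tok (\<lambda>_. Idle) vB \<subseteq> States" using vB by (auto simp: Tok_def States_def)
  then have "syncs (Tok (\<lambda>_. Idle) vB) w" using assms unfolding syncs_def by blast
  from Inv_length[OF Inv_idle this, of 0] show ?thesis by simp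
qed

end

subsection \<open>A synchronising word\<close>

context ring
begin

definition goes :: "state set \<Rightarrow> state set \<Rightarrow> bool" where
  "goes S T \<longleftrightarrow> (\<exists>w. set w \<subseteq> {..<2} \<and> leads \<delta> w S T)"

lemma goes_refl: "S \<subseteq> T \<Longrightarrow> goes S T"
  unfolding goes_def by (rule exI[of _ "[]"]) (simp add: leads_Nil)

lemma goes_trans: "goes S T \<Longrightarrow> goes T U \<Longrightarrow> goes S U"
  unfolding goes_def using leads_append by (metis le_sup_iff set_append)

lemma goes_run: "(\<And>s. s \<in> S \<Longrightarrow> \<exists>t\<in>T. run \<delta> s w = Some t) \<Longrightarrow> set w \<subseteq> {..<2} \<Longrightarrow> goes S T"
  by (auto simp: goes_def leads_def)

lemma goes_step: "(\<And>s. s \<in> S \<Longrightarrow> \<exists>t\<in>T. \<delta> s a = Some t) \<Longrightarrow> a < 2 \<Longrightarrow> goes S T"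
  unfolding goes_def by (rule exI[of _ "[a]"]) (simp add: leads_single)

lemma goes_image: "(\<lambda>s. \<delta> s a) ` S = Some ` T \<Longrightarrow> a < 2 \<Longrightarrow> goes S T"
  by (rule goes_step) (auto dest: equalityD1)

lemma goes_mono: "goes S T \<Longrightarrow> T \<subseteq> U \<Longrightarrow> goes S U"
  by (rule goes_trans[OF _ goes_refl])

section \<open>Resetting by total letters\<close>

definition Tk :: "nat \<Rightarrow> state set" where "Tk c = (if \<kappa> = 0 then {} else {Ctl c})"

lemma vB_less: "0 < \<kappa> \<Longrightarrow> vB < \<kappa>"
  using cy_less[of 0] cy_0 by simp

lemma cy_vB: "cy vB = vB"
  using cy_cy by metis

lemma run_y_Idle: "j < N \<Longrightarrow> run \<delta> (Ring j Idle) (replicate m 1) = Some (Ring ((j + m) mod N) Idle)"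
proof (induction m arbitrary: j)
  case (Suc m)
  have "run \<delta> (Ring j Idle) (replicate (Suc m) 1) = run \<delta> (Ring (nxt j) Idle) (replicate m 1)" by simp
  also have "\<dots> = Some (Ring ((nxt j + m) mod N) Idle)" by (rule Suc.IH[OF nxt_less[OF Suc.prems]])
  also have "(nxt j + m) mod N = (j + Suc m) mod N" unfolding nxt_mod[OF Suc.prems] by (simp add: mod_add_left_eq)
  finally show ?case .
qed simp

text \<open>Whatever starts at position 0 without being \<open>Idle\<close> is \<open>Err\<close> at
  position 3 and \<open>Idle\<close> at position 4.\<close>

lemma run_y_0: "valid 0 l \<Longrightarrow> run \<delta> (Ring 0 l) (replicate 4 1) = Some (Ring 4 Idle)"
proof -
  have "replicate 4 1 = [1, 1, 1, 1 :: nat]" by (simp add: numeral_eq_Suc)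
  moreover assume "valid 0 l"
  ultimately show ?thesis by (cases l) (auto simp: valid_def)
qed

lemma run_y_to_0:
  "valid j l \<Longrightarrow> N - j = d \<Longrightarrow> \<exists>l'. valid 0 l' \<and> run \<delta> (Ring j l) (replicate d 1) = Some (Ring 0 l')"
proof (induction d arbitrary: j l)
  case 0
  then show ?case by (simp add: valid_def)
next
  case (Suc d)
  have v: "valid (nxt j) (ylab b j l)" by (rule valid_y[OF Suc.prems(1)])
  have r: "run \<delta> (Ring j l) (replicate (Suc d) 1) = run \<delta> (Ring (nxt j) (ylab b j l)) (replicate d 1)" by simp
  show ?case
  proof (cases "Suc j = N")
    case True
    then have "d = 0" "nxt j = 0" using Suc.prems(2) by (auto simp: nxt_def)
    then show ?thesis using v r by simp
  next
    case False
    then have "N - nxt j = d" using Suc.prems(2) by (simp add: nxt_def)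
    from Suc.IH[OF v this] show ?thesis unfolding r .
  qed
qed

lemma run_y_Ctl: "run \<delta> (Ctl c) (replicate (Suc (Suc m)) 1) = Some (Ctl vB)"
proof -
  have "run \<delta> (Ctl vB) (replicate m 1) = Some (Ctl vB)" by (induction m) (simp_all add: cy_vB)
  then show ?thesis by (simp add: cy_cy)
qed

fun settled :: "state \<Rightarrow> state" where
  "settled (Ring j l) = Ring j Idle"
| "settled (Ctl c) = Ctl vB"

text \<open>At most \<open>N\<close> letters lead to position 0 and four more to
  \<open>Idle\<close>; \<open>2 * N\<close> leaves room for both and is a multiple of
  \<open>N\<close>, so every token is back at its place.\<close>

lemma run_y_settled:
  assumes "s \<in> States"
  shows "run \<delta> s (replicate (2 * N) 1) = Some (settled s)"
proof (cases s)
  case (Ring j l)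
  then have v: "valid j l" using assms by (auto simp: States_def)
  then have j: "j < N" by (simp add: valid_def)
  obtain l' where l': "valid 0 l'" "run \<delta> (Ring j l) (replicate (N - j) 1) = Some (Ring 0 l')"
    using run_y_to_0[OF v] by blast
  have "2 * N = (N - j) + (4 + (N + j - 4))" using j N_ge by simp
  then have rep: "replicate (2 * N) (1::nat) = replicate (N - j) 1 @ replicate 4 1 @ replicate (N + j - 4) 1"
    by (simp only: replicate_add)
  have "(4 + (N + j - 4)) mod N = j" using j N_ge by simp
  then show ?thesis unfolding rep Ring run_append l'(2) using run_y_0[OF l'(1)] run_y_Idle[OF lt_N(5)]
    by (simp del: replicate_Suc)
next
  case (Ctl c)
  have "2 * N = Suc (Suc (2 * N - 2))" using N_ge by simp
  then show ?thesis using run_y_Ctl[of c "2 * N - 2"] Ctl by simp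
qed

lemma goes_settled: "S \<subseteq> States \<Longrightarrow> goes S (settled ` S)"
  using run_y_settled by (intro goes_run[of _ _ "replicate (2 * N) 1"]) (auto simp: set_replicate_conv_if)

lemma Tok_eq: "Tok f c = (\<lambda>j. Ring j (f j)) ` {..<N} \<union> Tk c"
  by (simp add: Tok_def Tk_def)

lemma goes_fresh: "goes States (Tok (mkx 1 (\<lambda>_. 0)) 0)"
proof (rule goes_trans)
  have "settled ` States \<subseteq> Tok (\<lambda>_. Idle) vB"
    by (auto simp: States_def Tok_def valid_def)
  then show "goes States (Tok (\<lambda>_. Idle) vB)" by (rule goes_mono[OF goes_settled[OF order_refl]])
  show "goes (Tok (\<lambda>_. Idle) vB) (Tok (mkx 1 (\<lambda>_. 0)) 0)"
    by (rule goes_image[OF Tok_x[OF _ idle_x cx_vB]]) auto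
qed

section \<open>Turning the ring and running the counter\<close>

fun rot :: "nat \<Rightarrow> state \<Rightarrow> state" where
  "rot m (Ring j l) = Ring ((j + m) mod N) l"
| "rot m (Ctl c) = Ctl c"

lemma run_x_still:
  assumes l: "xlab 0 l = Some l" "\<And>j. xlab j l = xlab 0 l" and "j < N"
  shows "run \<delta> (Ring j l) (replicate m 0) = Some (Ring ((j + m) mod N) l)"
  using assms(3)
proof (induction m arbitrary: j)
  case (Suc m)
  have "l \<noteq> Exit" using l by auto
  then have "run \<delta> (Ring j l) (replicate (Suc m) 0) = run \<delta> (Ring (nxt j) l) (replicate m 0)"
    using l by (simp add: l(2)[of j])
  also have "\<dots> = Some (Ring ((nxt j + m) mod N) l)" by (rule Suc.IH[OF nxt_less[OF Suc.prems]])
  also have "(nxt j + m) mod N = (j + Suc m) mod N" unfolding nxt_mod[OF Suc.prems] by (simp add: mod_add_left_eq)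
  finally show ?case .
qed simp

lemma run_x_Ctl:
  assumes "4 dvd m"
  shows "run \<delta> (Ctl 0) (replicate m 0) = Some (Ctl 0)"
proof -
  have 4: "run \<delta> (Ctl 0) (replicate 4 0) = Some (Ctl 0)"
    using cx4 by (auto simp: numeral_eq_Suc bind_eq_Some_conv)
  have "run \<delta> (Ctl 0) (replicate (4 * k) 0) = Some (Ctl 0)" for k
  proof (induction k)
    case (Suc k)
    have "replicate (4 * Suc k) (0::nat) = replicate 4 0 @ replicate (4 * k) 0"
      unfolding replicate_add[symmetric] by simp
    then show ?case using 4 Suc by (simp add: run_append)
  qed simp
  then show ?thesis using assms by auto
qed

lemma goes_rot:
  assumes "4 dvd m" "\<And>s. s \<in> S \<Longrightarrow> s = Ctl 0 \<or> (\<exists>j<N. s = Ring j Mark \<or> (\<exists>v. s = Ring j (Dig v)))"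
  shows "goes S (rot m ` S)"
proof (rule goes_run)
  fix s assume s: "s \<in> S"
  have "run \<delta> s (replicate m 0) = Some (rot m s)"
    using assms(2)[OF s] run_x_Ctl[OF assms(1)] run_x_still by auto
  then show "\<exists>t\<in>rot m ` S. run \<delta> s (replicate m 0) = Some t" using s by auto
qed (simp add: set_replicate_conv_if)

text \<open>\<open>(N + 1)\<^sup>2\<close> is 1 modulo \<open>N\<close> and, as \<open>N\<close> is
  odd, divisible by 4; multiply it by the distance from \<open>p\<close> to
  \<open>q\<close>.\<close>

lemma ex_shift: "p < N \<Longrightarrow> q < N \<Longrightarrow> \<exists>m. 4 dvd m \<and> (p + m) mod N = q"
proof -
  assume pq: "p < N" "q < N"
  define d where "d = q + N - p"
  have "p + d * (N + 1)\<^sup>2 = q + (1 + d * (N + 2)) * N"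
  proof -
    have "d * (N + 1)\<^sup>2 = d + d * (N + 2) * N" by (simp add: power2_eq_square algebra_simps)
    moreover have "p + d = q + N" using pq by (simp add: d_def)
    ultimately show ?thesis by (simp add: algebra_simps)
  qed
  then have "(p + d * (N + 1)\<^sup>2) mod N = q" using pq by (metis mod_less mod_mult_self1)
  moreover have "4 dvd d * (N + 1)\<^sup>2"
  proof -
    have "2 dvd N + 1" using N_odd by simp
    then have "2\<^sup>2 dvd (N + 1)\<^sup>2" by (rule dvd_power_same)
    then show ?thesis by simp
  qed
  ultimately show ?thesis by blast
qed

lemma rho_shift: "p < N \<Longrightarrow> j < N \<Longrightarrow> rho ((p + m) mod N) ((j + m) mod N) = rho p j"
proof (induction m)
  case (Suc m)
  have lt: "(p + m) mod N < N" "(j + m) mod N < N" using lt_N by auto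
  have "nxt ((p + m) mod N) = (p + Suc m) mod N" "nxt ((j + m) mod N) = (j + Suc m) mod N"
    using nxt_mod[OF lt(1)] nxt_mod[OF lt(2)] by (simp_all add: mod_Suc_eq)
  then show ?case using rho_nxt[OF lt] Suc by simp
qed simp

lemma goes_turn:
  assumes p: "p < N" "q < N" and e: "\<And>r. 0 < r \<Longrightarrow> r < N \<Longrightarrow> e r < b"
  shows "goes (Tok (mkx p e) 0) (Tok (mkx q e) 0)"
proof -
  obtain m where m: "4 dvd m" "(p + m) mod N = q" using ex_shift[OF p] by blast
  have lab: "mkx p e j = Mark \<or> (\<exists>v. mkx p e j = Dig v)" if j: "j < N" for j
    using e[of "rho p j"] rho_less[OF p(1) j] by (auto simp: mkx_def Let_def)
  have "goes (Tok (mkx p e) 0) (rot m ` Tok (mkx p e) 0)"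
    by (rule goes_rot[OF m(1)]) (use lab in \<open>auto simp: Tok_def split: if_splits\<close>)
  moreover have "rot m ` Tok (mkx p e) 0 \<subseteq> Tok (mkx q e) 0"
  proof -
    have "Ring ((j + m) mod N) (mkx p e j) \<in> Tok (mkx q e) 0" if j: "j < N" for j
    proof -
      have "mkx p e j = mkx q e ((j + m) mod N)" using rho_shift[OF p(1) j, of m] m(2) by (simp add: mkx_def)
      then show ?thesis using lt_N by (auto simp: Tok_def)
    qed
    then show ?thesis by (auto simp: Tok_eq Tk_def)
  qed
  ultimately show ?thesis by (rule goes_mono)
qed

text \<open>A total letter and a partial one move the digit just raised from position 0 to position
  2, which prepares the next carry. With \<open>p = 0\<close> the mark would exit instead.\<close>

lemma goes_yx:
  assumes ok: "okx p e" and leg: "legal p e" and p: "p \<noteq> 0"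
  shows "goes (Tok (mkx p e) 0) (Tok (mkx ((p + 2) mod N) (incr p e)) 0)"
proof -
  have pN: "p < N" using ok unfolding okx_def by blast
  have "goes (Tok (mkx p e) 0) (Tok (mky (nxt p) (incr p e)) (cy 0))"
    by (rule goes_image[OF Tok_y[where a = 0, OF mkx_y[OF ok leg]]]) auto
  moreover have "goes (Tok (mky (nxt p) (incr p e)) vB) (Tok (mkx (nxt (nxt p)) (incr p e)) 0)"
    by (rule goes_image[OF Tok_x[OF mky_x[OF oky_y[OF ok leg]] cx_vB]]) (use p nxt_eq_1[OF pN] in auto)
  moreover have "nxt (nxt p) = (p + 2) mod N"
    using nxt_mod[OF nxt_less[OF pN]] nxt_mod[OF pN] by (simp add: mod_Suc_eq)
  ultimately show ?thesis unfolding cy_0 using goes_trans by metis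
qed

lemma rho_22: "rho 2 2 = 0" using rho_0_iff lt_N by simp

text \<open>The first increment is legal because the marker is at position 2, each later one because
  the digit below has just overflowed from \<open>b - 1\<close>.\<close>

lemma goes_carry:
  assumes e: "\<And>r. 0 < r \<Longrightarrow> r < N \<Longrightarrow> e r < b" and s: "0 < s" "s < N"
    and top: "\<And>r. 0 < r \<Longrightarrow> r < s \<Longrightarrow> e r = b - 1"
  shows "goes (Tok (mkx 2 e) 0)
    (Tok (mkx ((2 + 2 * s) mod N) (\<lambda>r. if r < s then 0 else if r = s then e s + 1 else e r)) 0)"
  using s top
proof (induction s rule: nat_induct_non_zero)
  case 1
  have ok: "okx 2 e" unfolding okx_def using e lt_N by (metis less_imp_le nat_neq_iff)
  have "incr 2 e = (\<lambda>r. if r < 1 then 0 else if r = 1 then e 1 + 1 else e r)"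
    by (rule ext) (simp add: incr_def rho_22 rho_20)
  then show ?case using goes_yx[OF ok] by (simp add: legal_def)
next
  case (Suc s)
  define E where "E = (\<lambda>r. if r < s then 0 else if r = s then e s + 1 else e r)"
  define p where "p = (2 + 2 * s) mod N"
  have IH: "goes (Tok (mkx 2 e) 0) (Tok (mkx p E) 0)"
    unfolding E_def p_def using Suc.IH Suc.prems by simp
  have pN: "p < N" using lt_N by (simp add: p_def)
  have r2: "rho p 2 = s" using rho_2_eq[OF pN] Suc.prems(1) p_def by simp
  have p0: "p \<noteq> 0"
  proof
    assume "p = 0"
    then have "s = N - 1" using r2 rho_02 by simp
    then show False using Suc.prems(1) by simp
  qed
  have p2: "p \<noteq> 2" using r2 rho_22 Suc.hyps by auto
  have r0: "rho p 0 = Suc s" using rho_pred[OF pN p0 p2] r2 by simp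
  have Es: "E s = b" using Suc.prems(2)[of s] Suc.hyps b_pos by (simp add: E_def)
  have ok: "okx p E" unfolding okx_def r2
  proof (intro conjI allI impI)
    fix r assume r: "0 < r" "r < N"
    show "E r \<le> b" using e[OF r] Es by (cases "r = s") (simp_all add: E_def)
    show "r = s" if "E r = b" using that e[OF r] b_pos by (auto simp: E_def split: if_splits)
  qed (rule pN)
  have "legal p E" using r2 Es by (simp add: legal_def)
  note step = goes_yx[OF ok this p0]
  have "incr p E = (\<lambda>r. if r < Suc s then 0 else if r = Suc s then e (Suc s) + 1 else e r)"
    by (rule ext) (auto simp: incr_def r0 r2 E_def)
  moreover have "(p + 2) mod N = (2 + 2 * s + 2) mod N" unfolding p_def by (rule mod_add_left_eq)
  then have "(p + 2) mod N = (2 + 2 * Suc s) mod N" by simp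
  ultimately show ?case using goes_trans[OF IH step] by simp
qed

lemma goes_increment:
  assumes e: "\<And>r. 0 < r \<Longrightarrow> r < N \<Longrightarrow> e r < b" and i: "0 < i" "i < N"
    and top: "\<And>r. 0 < r \<Longrightarrow> r < i \<Longrightarrow> e r = b - 1" and ei: "e i + 1 < b"
  shows "goes (Tok (mkx 2 e) 0) (Tok (mkx 2 (\<lambda>r. if r < i then 0 else if r = i then e i + 1 else e r)) 0)"
  using goes_carry[OF e i top]
  by (rule goes_trans) (use e ei b_pos lt_N in \<open>auto intro!: goes_turn\<close>)

text \<open>Nested induction: fill the digits below \<open>i\<close>, raise digit \<open>i\<close>
  by one, which clears them, and fill them again.\<close>

lemma goes_full:
  assumes "i \<le> N" "\<And>r. r < N \<Longrightarrow> f r < b" "\<And>r. r < i \<Longrightarrow> f r = 0"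
  shows "goes (Tok (mkx 2 f) 0) (Tok (mkx 2 (\<lambda>r. if 0 < r \<and> r < i then b - 1 else f r)) 0)"
  using assms
proof (induction i arbitrary: f)
  case 0
  then show ?case by (simp add: goes_refl)
next
  case (Suc i)
  show ?case
  proof (cases "i = 0")
    case True
    then have "(\<lambda>r. if 0 < r \<and> r < Suc i then b - 1 else f r) = f" by (intro ext) auto
    then show ?thesis by (simp add: goes_refl)
  next
    case False
    have "goes (Tok (mkx 2 f) 0) (Tok (mkx 2 (\<lambda>r. if 0 < r \<and> r < i then b - 1 else if r = i then v else f r)) 0)"
      if "v < b" for v
      using that
    proof (induction v)
      case 0
      have "(\<lambda>r. if 0 < r \<and> r < i then b - 1 else if r = i then 0 else f r) = (\<lambda>r. if 0 < r \<and> r < i then b - 1 else f r)"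
        by (rule ext) (simp add: Suc.prems(3))
      then show ?case using Suc.IH[of f] Suc.prems by simp
    next
      case (Suc v)
      define g where "g = (\<lambda>r. if 0 < r \<and> r < i then b - 1 else if r = i then v else f r)"
      define h where "h = (\<lambda>r. if r < i then 0 else if r = i then v + 1 else f r)"
      have "goes (Tok (mkx 2 g) 0) (Tok (mkx 2 (\<lambda>r. if r < i then 0 else if r = i then g i + 1 else g r)) 0)"
        by (rule goes_increment)
          (use \<open>Suc i \<le> N\<close> \<open>i \<noteq> 0\<close> \<open>Suc v < b\<close> \<open>\<And>r. r < N \<Longrightarrow> f r < b\<close> in \<open>auto simp: g_def\<close>)
      moreover have "(\<lambda>r. if r < i then 0 else if r = i then g i + 1 else g r) = h"
        by (rule ext) (simp add: g_def h_def)
      \<comment> \<open>The refill is the outer induction hypothesis, applied to the digits after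
        the increment.\<close>
      moreover have "goes (Tok (mkx 2 h) 0) (Tok (mkx 2 (\<lambda>r. if 0 < r \<and> r < i then b - 1 else h r)) 0)"
        by (rule \<open>\<And>f. i \<le> N \<Longrightarrow> (\<And>r. r < N \<Longrightarrow> f r < b) \<Longrightarrow> (\<And>r. r < i \<Longrightarrow> f r = 0) \<Longrightarrow>
            goes (Tok (mkx 2 f) 0) (Tok (mkx 2 (\<lambda>r. if 0 < r \<and> r < i then b - 1 else f r)) 0)\<close>)
          (use \<open>Suc i \<le> N\<close> \<open>Suc v < b\<close> \<open>\<And>r. r < N \<Longrightarrow> f r < b\<close> in \<open>auto simp: h_def\<close>)
      moreover have "(\<lambda>r. if 0 < r \<and> r < i then b - 1 else h r)
          = (\<lambda>r. if 0 < r \<and> r < i then b - 1 else if r = i then Suc v else f r)"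
        by (rule ext) (use \<open>\<And>r. r < Suc i \<Longrightarrow> f r = 0\<close> \<open>i \<noteq> 0\<close> in \<open>auto simp: h_def\<close>)
      moreover have "goes (Tok (mkx 2 f) 0) (Tok (mkx 2 g) 0)"
        unfolding g_def using Suc.IH Suc.prems by simp
      ultimately show ?case using goes_trans by metis
    qed
    from this[of "b - 1"] have "goes (Tok (mkx 2 f) 0)
        (Tok (mkx 2 (\<lambda>r. if 0 < r \<and> r < i then b - 1 else if r = i then b - 1 else f r)) 0)"
      using b_pos by simp
    moreover have "(\<lambda>r. if 0 < r \<and> r < i then b - 1 else if r = i then b - 1 else f r)
        = (\<lambda>r. if 0 < r \<and> r < Suc i then b - 1 else f r)"
      by (rule ext) (use False in auto)
    ultimately show ?thesis by simp
  qed
qed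

section \<open>Removing the tokens one after another\<close>

text \<open>The tokens left after slots \<open>0\<close> to \<open>i - 1\<close> have been emptied;
  \<open>q\<close> is the position of slot 0 and serves as reference although no token need be
  there.\<close>

definition Rest :: "nat \<Rightarrow> nat \<Rightarrow> state set" where
  "Rest i q = {Ring j Idle | j. j < N \<and> i \<le> rho q j} \<union> Tk vB"

lemma fin_States: "fin \<in> States"
  using b_pos lt_N by (auto simp: fin_def States_def valid_def)

lemma settled_fin: "settled fin = (if \<kappa> = 0 then Ring 0 Idle else Ctl vB)"
  by (simp add: fin_def)

text \<open>Count up to all digits \<open>b - 1\<close> and carry through the last digit; this
  brings the marker to position \<open>2 * N\<close>, that is 0, where the exit is legal.\<close>

lemma goes_first_exit: "goes (Tok (mkx 1 (\<lambda>_. 0)) 0) (Rest 1 2)"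
proof -
  define E where "E = (\<lambda>r. if 0 < r \<and> r < N then b - 1 else 0)"
  define E' where "E' = (\<lambda>r. if r < N - 1 then 0 else if r = N - 1 then E (N - 1) + 1 else E r)"
  have 1: "goes (Tok (mkx 1 (\<lambda>_. 0)) 0) (Tok (mkx 2 (\<lambda>_. 0)) 0)"
    by (rule goes_turn) (use lt_N b_pos in auto)
  have 2: "goes (Tok (mkx 2 (\<lambda>_. 0)) 0) (Tok (mkx 2 E) 0)"
    unfolding E_def by (rule goes_full) (use b_pos in auto)
  have "goes (Tok (mkx 2 E) 0) (Tok (mkx ((2 + 2 * (N - 1)) mod N) E') 0)"
    unfolding E'_def by (rule goes_carry) (use b_pos lt_N in \<open>auto simp: E_def\<close>)
  moreover have "2 + 2 * (N - 1) = 2 * N" using lt_N by simp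
  ultimately have 3: "goes (Tok (mkx 2 E) 0) (Tok (mkx 0 E') 0)" by simp
  have Eb: "E' (N - 1) = b" using lt_N b_pos by (simp add: E'_def E_def)
  have ok: "okx 0 E'" unfolding okx_def rho_02
  proof (intro conjI allI impI)
    fix r assume r: "0 < r" "r < N"
    show "E' r \<le> b" using r Eb by (cases "r = N - 1") (auto simp: E'_def)
    show "r = N - 1" if "E' r = b" using that r b_pos by (auto simp: E'_def split: if_splits)
  qed (rule lt_N)
  have leg: "legal 0 E'" using Eb by (simp add: legal_def rho_02)
  have "goes (Tok (mkx 0 E') 0) (Tok (mky (nxt 0) (incr 0 E')) (cy 0))"
    by (rule goes_image[OF Tok_y[where a = 0, OF mkx_y[OF ok leg]]]) auto
  then have 4: "goes (Tok (mkx 0 E') 0) (Tok (mky 1 (incr 0 E')) vB)" by (simp add: cy_0)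
  \<comment> \<open>The token that was \<open>Exit\<close> at position 1 is gone, hence the hole at
    position 2.\<close>
  define S where "S = {Ring j (Dig 0) | j. j < N \<and> j \<noteq> 2} \<union> {fin} \<union> Tk 0"
  have 5: "goes (Tok (mky 1 (incr 0 E')) vB) S"
  proof (rule goes_step[where a = 0])
    fix s assume "s \<in> Tok (mky 1 (incr 0 E')) vB"
    then consider j where "j < N" "s = Ring j (mky 1 (incr 0 E') j)" | "s \<in> Tk vB"
      by (auto simp: Tok_eq)
    then show "\<exists>t\<in>S. \<delta> s 0 = Some t"
    proof cases
      case (1 j)
      show ?thesis
      proof (cases "j = 1")
        case True
        then have "mky 1 (incr 0 E') j = Exit" using rho_0_iff lt_N by (simp add: mky_def)
        then show ?thesis using 1 by (simp add: S_def)
      next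
        case False
        then have r: "rho 1 j \<noteq> 0" "rho 1 j < N" using rho_0_iff[OF lt_N(2) 1(1)] rho_less[OF lt_N(2) 1(1)] by auto
        have "rho 0 0 = 0" using rho_0_iff lt_N by simp
        then have "incr 0 E' (rho 1 j) = 0" using r by (auto simp: incr_def rho_02 E'_def)
        then have "mky 1 (incr 0 E') j = (if j = 3 then Idle else Dig 0)" using r b_pos by (simp add: mky_def Let_def)
        then have "\<delta> s 0 = Some (Ring (nxt j) (Dig 0))" using 1 by simp
        moreover have "nxt j < N" "nxt j \<noteq> 2" using nxt_less[OF 1(1)] nxt_eq_2[OF 1(1)] False by auto
        ultimately show ?thesis by (simp add: S_def)
      qed
    next
      case 2
      then show ?thesis using cx_vB by (auto simp: Tk_def S_def split: if_splits)
    qed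
  qed simp
  have "S \<subseteq> States" using fin_States b_pos cy_less by (auto simp: S_def States_def valid_def Tk_def split: if_splits)
  then have 6: "goes S (settled ` S)" by (rule goes_settled)
  have pos: "1 \<le> rho 2 j" if "j < N" "j \<noteq> 2" for j using rho_0_iff[OF lt_N(3) that(1)] that(2) by simp
  have "settled ` S \<subseteq> Rest 1 2"
    using pos lt_N by (auto simp: S_def Rest_def settled_fin Tk_def split: if_splits)
  then have "goes S (Rest 1 2)" by (rule goes_mono[OF 6])
  then show ?thesis using 1 2 3 4 5 goes_trans by metis
qed

lemma goes_Rest_turn:
  assumes "q < N" "q' < N"
  shows "goes (Rest i q) (Rest i q')"
proof -
  define m where "m = Suc (Suc (q' + N + N - q - 2))"
  have m2: "m = q' + N + N - q" using assms N_ge by (simp add: m_def)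
  have m: "(q + m) mod N = q'"
  proof -
    have "q + m = q' + 2 * N" using assms m2 by simp
    then show ?thesis using assms by simp
  qed
  show ?thesis
  proof (rule goes_run[of _ _ "replicate m 1"])
    fix s assume "s \<in> Rest i q"
    then consider j where "j < N" "s = Ring j Idle" "i \<le> rho q j" | "s \<in> Tk vB" by (auto simp: Rest_def)
    then show "\<exists>t\<in>Rest i q'. run \<delta> s (replicate m 1) = Some t"
    proof cases
      case (1 j)
      have "Ring ((j + m) mod N) Idle \<in> Rest i q'"
        using rho_shift[OF assms(1) 1(1), of m] 1 m lt_N by (auto simp: Rest_def)
      then show ?thesis using run_y_Idle[OF 1(1)] 1(2) by blast
    next
      case 2
      then show ?thesis using run_y_Ctl[of vB] by (auto simp: Rest_def Tk_def m_def simp del: replicate_Suc split: if_splits)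
    qed
  qed (simp add: set_replicate_conv_if)
qed

text \<open>The slot with the smallest remaining number becomes the marker. Its predecessor is empty, so it may
  exit at once.\<close>

lemma goes_next_exit:
  assumes i: "0 < i" "i < N" "\<kappa> = 0 \<Longrightarrow> Suc i < N" and q: "q < N"
  shows "goes (Rest i q) (Rest (Suc i) ((2 * i + 2) mod N))"
proof -
  \<comment> \<open>With reference position \<open>q0\<close>, slot \<open>i\<close> stands at
    position 0 and is the one that the partial letter turns into the mark.\<close>
  define q0 where "q0 = (2 * i) mod N"
  define DD where "DD q = {Ring j (Dig 0) | j. j < N \<and> i < rho q j}" for q
  have q0: "q0 < N" using lt_N by (simp add: q0_def)
  have q1: "nxt q0 < N" and q2: "nxt (nxt q0) < N" using nxt_less q0 by auto
  have r0: "rho q0 0 = i"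
    by (rule rho_eqI[OF q0 lt_N(1) i(2), where k = "2 * i div N"]) (simp add: q0_def)
  have q00: "q0 \<noteq> 0" using r0 rho_0_iff[OF q0 lt_N(1)] i by auto
  have r2: "rho q0 2 < i"
  proof (cases "q0 = 2")
    case True
    then show ?thesis using rho_22 i by simp
  next
    case False
    then show ?thesis using rho_pred[OF q0 q00] r0 by simp
  qed
  have DDn: "Ring (nxt j) (Dig 0) \<in> DD (nxt q)" if "j < N" "q < N" "i < rho q j" for j q
    using rho_nxt[OF that(2,1)] that nxt_less[OF that(1)] by (auto simp: DD_def)
  have 1: "goes (Rest i q) (Rest i q0)" by (rule goes_Rest_turn[OF q q0])
  have 2: "goes (Rest i q0) ({Ring 1 Mark} \<union> DD (nxt q0) \<union> Tk 0)"
  proof (rule goes_step[where a = 0])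
    fix s assume "s \<in> Rest i q0"
    then consider j where "j < N" "s = Ring j Idle" "i \<le> rho q0 j" | "s \<in> Tk vB" by (auto simp: Rest_def)
    then show "\<exists>t\<in>{Ring 1 Mark} \<union> DD (nxt q0) \<union> Tk 0. \<delta> s 0 = Some t"
    proof cases
      case (1 j)
      show ?thesis
      proof (cases "j = 0")
        case False
        then have "rho q0 j \<noteq> i" using rho_inj[OF q0 1(1) lt_N(1)] r0 by auto
        then have "i < rho q0 j" using 1 by simp
        from DDn[OF 1(1) q0 this] show ?thesis using 1 False by simp
      qed (use 1 in simp)
    next
      case 2
      then show ?thesis using cx_vB by (auto simp: Tk_def split: if_splits)
    qed
  qed simp
  obtain m where m: "4 dvd m" "(1 + m) mod N = 0"
    using ex_shift[OF lt_N(2) lt_N(1)] by (elim exE conjE) (rule that)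
  have 3: "goes ({Ring 1 Mark} \<union> DD (nxt q0) \<union> Tk 0) ({Ring 0 Mark} \<union> DD q0 \<union> Tk 0)"
  proof (rule goes_mono[OF goes_rot[OF m(1)]])
    fix s assume "s \<in> {Ring 1 Mark} \<union> DD (nxt q0) \<union> Tk 0"
    then show "s = Ctl 0 \<or> (\<exists>j<N. s = Ring j Mark \<or> (\<exists>v. s = Ring j (Dig v)))"
      using lt_N by (auto simp: DD_def Tk_def split: if_splits)
  next
    have nm: "(nxt q0 + m) mod N = q0"
    proof -
      have "(nxt q0 + m) mod N = (q0 + (1 + m)) mod N" unfolding nxt_mod[OF q0] by (simp add: mod_Suc_eq mod_add_left_eq)
      also have "\<dots> = (q0 + (1 + m) mod N) mod N" by (rule mod_add_right_eq[symmetric])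
      finally show ?thesis using m q0 by simp
    qed
    have "Ring ((j + m) mod N) (Dig 0) \<in> DD q0" if "j < N" "i < rho (nxt q0) j" for j
      using rho_shift[OF q1 that(1), of m] that nm lt_N by (auto simp: DD_def)
    then show "rot m ` ({Ring 1 Mark} \<union> DD (nxt q0) \<union> Tk 0) \<subseteq> {Ring 0 Mark} \<union> DD q0 \<union> Tk 0"
      using m(2) by (auto simp: DD_def[of "nxt q0"] Tk_def)
  qed
  have 4: "goes ({Ring 0 Mark} \<union> DD q0 \<union> Tk 0) ({Ring 1 Exit} \<union> DD (nxt q0) \<union> Tk vB)"
  proof (rule goes_step[where a = 1])
    fix s assume "s \<in> {Ring 0 Mark} \<union> DD q0 \<union> Tk 0"
    then consider "s = Ring 0 Mark" | j where "j < N" "s = Ring j (Dig 0)" "i < rho q0 j" | "s \<in> Tk 0"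
      by (auto simp: DD_def)
    then show "\<exists>t\<in>{Ring 1 Exit} \<union> DD (nxt q0) \<union> Tk vB. \<delta> s 1 = Some t"
    proof cases
      case (2 j)
      have "j \<noteq> 0" using 2(3) r0 by (metis less_irrefl_nat)
      moreover have "j \<noteq> 2" using 2(3) r2 by (metis less_asym)
      ultimately show ?thesis using DDn[OF 2(1) q0 2(3)] 2(2) by simp
    next
      case 3
      then show ?thesis using cy_0 by (auto simp: Tk_def split: if_splits)
    qed simp
  qed simp
  have 5: "goes ({Ring 1 Exit} \<union> DD (nxt q0) \<union> Tk vB) ({fin} \<union> DD (nxt (nxt q0)) \<union> Tk 0)"
  proof (rule goes_step[where a = 0])
    fix s assume "s \<in> {Ring 1 Exit} \<union> DD (nxt q0) \<union> Tk vB"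
    then consider "s = Ring 1 Exit" | j where "j < N" "s = Ring j (Dig 0)" "i < rho (nxt q0) j" | "s \<in> Tk vB"
      by (auto simp: DD_def)
    then show "\<exists>t\<in>{fin} \<union> DD (nxt (nxt q0)) \<union> Tk 0. \<delta> s 0 = Some t"
    proof cases
      case (2 j)
      then show ?thesis using DDn[OF 2(1) q1 2(3)] by simp
    next
      case 3
      then show ?thesis using cx_vB by (auto simp: Tk_def split: if_splits)
    qed simp
  qed simp
  have nn: "nxt (nxt q0) = (2 * i + 2) mod N"
    using nxt_mod[OF q1] nxt_mod[OF q0] by (simp add: q0_def mod_Suc_eq)
  let ?S = "{fin} \<union> DD (nxt (nxt q0)) \<union> Tk 0"
  have "?S \<subseteq> States" using fin_States b_pos by (auto simp: DD_def States_def valid_def Tk_def split: if_splits)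
  then have 6: "goes ?S (settled ` ?S)" by (rule goes_settled)
  \<comment> \<open>Without control the mark lands in slot \<open>Suc i\<close>, which must be one
    of the slots that remain.\<close>
  have "Suc i \<le> rho (nxt (nxt q0)) 0" if "\<kappa> = 0"
  proof -
    have "rho (nxt (nxt q0)) 0 = Suc i"
      by (rule rho_eqI[OF q2 lt_N(1) i(3)[OF that], where k = "(2 * i + 2) div N"]) (simp add: nn)
    then show ?thesis by simp
  qed
  then have "settled fin \<in> Rest (Suc i) (nxt (nxt q0))"
    using lt_N by (auto simp: settled_fin Rest_def Tk_def)
  moreover have "settled ` DD (nxt (nxt q0)) \<subseteq> Rest (Suc i) (nxt (nxt q0))"
    by (auto simp: DD_def Rest_def)
  moreover have "settled ` Tk 0 \<subseteq> Rest (Suc i) (nxt (nxt q0))"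
    by (auto simp: Rest_def Tk_def)
  ultimately have "settled ` ?S \<subseteq> Rest (Suc i) (nxt (nxt q0))" unfolding image_Un by blast
  then have "goes ?S (Rest (Suc i) (nxt (nxt q0)))" by (rule goes_mono[OF 6])
  then show ?thesis unfolding nn[symmetric] using 1 2 3 4 5 goes_trans by metis
qed

lemma sync_exists:
  "\<exists>w s. set w \<subseteq> {..<2} \<and> w \<noteq> [] \<and> s \<in> States \<and> (\<forall>p\<in>States. run \<delta> p w = Some s)"
proof -
  \<comment> \<open>Without control one ring token has to stay as the target; with control all of
    them end on the control token.\<close>
  define M where "M = (if \<kappa> = 0 then N - 1 else N)"
  have "\<exists>q<N. goes States (Rest i q)" if "0 < i" "i \<le> M" for i
    using that
  proof (induction i rule: nat_induct_non_zero)
    case 1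
    show ?case using goes_trans[OF goes_fresh goes_first_exit] lt_N by blast
  next
    case (Suc i)
    then obtain q where q: "q < N" "goes States (Rest i q)" by auto
    have "goes (Rest i q) (Rest (Suc i) ((2 * i + 2) mod N))"
      by (rule goes_next_exit) (use Suc q in \<open>auto simp: M_def split: if_splits\<close>)
    then show ?case using goes_trans[OF q(2)] lt_N(1) by (meson mod_less_divisor)
  qed
  moreover have "0 < M" using lt_N by (simp add: M_def)
  ultimately obtain q where q: "q < N" "goes States (Rest M q)" by auto
  have "\<exists>s\<in>States. Rest M q \<subseteq> {s}"
  proof (cases "\<kappa> = 0")
    case True
    have eq: "x = y" if xy: "x \<in> Rest M q" "y \<in> Rest M q" for x y
    proof -
      obtain i j where ij: "x = Ring i Idle" "y = Ring j Idle" "i < N" "j < N" "M \<le> rho q i" "M \<le> rho q j"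
        using xy True unfolding Rest_def Tk_def by auto
      have "rho q i = rho q j" using ij rho_less[OF q(1) ij(3)] rho_less[OF q(1) ij(4)] True by (simp add: M_def)
      then show ?thesis using rho_inj[OF q(1) ij(3,4)] ij by simp
    qed
    have sub: "Rest M q \<subseteq> States" using True unfolding Rest_def Tk_def States_def valid_def by auto
    show ?thesis
    proof (cases "Rest M q = {}")
      case True
      then show ?thesis using fin_States by auto
    next
      case False
      then obtain x where x: "x \<in> Rest M q" by blast
      then have "Rest M q \<subseteq> {x}" using eq by blast
      then show ?thesis using x sub by blast
    qed
  next
    case False
    then have "\<not> M \<le> rho q j" if "j < N" for j using rho_less[OF q(1) that] by (simp add: M_def)
    then have "Rest M q \<subseteq> {Ctl vB}" unfolding Rest_def Tk_def using False by auto
    moreover have "Ctl vB \<in> States" using False vB_less by (auto simp: States_def)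
    ultimately show ?thesis by blast
  qed
  then obtain s where s: "s \<in> States" "Rest M q \<subseteq> {s}" by blast
  obtain w where w: "set w \<subseteq> {..<2}" "leads \<delta> w States {s}"
    using goes_mono[OF q(2) s(2)] by (auto simp: goes_def)
  have "w \<noteq> []"
  proof
    assume "w = []"
    moreover have "Ring 0 Idle \<in> States" "Ring 1 Idle \<in> States" using lt_N by (auto simp: States_def valid_def)
    moreover have "p = s" if "p \<in> States" for p using w(2) \<open>w = []\<close> that by (simp add: leads_def)
    ultimately show False by (metis state.inject(1) zero_neq_one)
  qed
  then show ?thesis using w s(1) by (auto simp: leads_def)
qed

end

context ring_potential
begin

lemma le_car:
  assumes "(b + 2) * N + 4 + \<kappa> \<le> n"
  shows "L \<le> car n 2"
proof -
  obtain w s where w: "set w \<subseteq> {..<2}" "w \<noteq> []" "s \<in> States" "\<forall>p\<in>States. run \<delta> p w = Some s"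
    using sync_exists by blast
  show ?thesis
  proof (rule car_ge[of States n 2 \<delta> w s])
    show "card States \<le> n" using card_States assms by linarith
    show "\<And>p a q. p \<in> States \<Longrightarrow> a < 2 \<Longrightarrow> \<delta> p a = Some q \<Longrightarrow> q \<in> States" by (rule \<delta>_closed)
    show "\<And>w q. (\<And>p. p \<in> States \<Longrightarrow> run \<delta> p w = Some q) \<Longrightarrow> L \<le> length w" by (rule sync_length)
  qed (use w finite_States in auto)
qed

end

subsection \<open>The two families and the theorem\<close>

text \<open>Without control every increment starts with the marker at position 2 and so costs at
  least one turn of \<open>N\<close> letters; \<open>D\<close> counts the letters until the marker
  is there again.\<close>

lemma car_ge_basic:
  assumes N: "odd N" "5 \<le> N" and b: "0 < b" and n: "(b + 2) * N + 4 \<le> n"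
  shows "N * b ^ (N - 1) + 1 \<le> car n 2"
proof -
  interpret ring N b 0 0 "\<lambda>_. Some 0" "\<lambda>_. 0"
    by unfold_locales (use N b in auto)
  define wt where "wt r = (if r = 0 then 0 else N * b ^ (r - 1))" for r
  define D where "D c p = (if p \<le> 2 then 2 - p else N + 2 - p)" for c p :: nat
  have carry: "wt (Suc (rho p 2)) = b * wt (rho p 2)" if "p < N" "p \<noteq> 2" for p
  proof -
    have "rho p 2 \<noteq> 0" using rho_0_iff[OF that(1) lt_N(3)] that(2) by simp
    then show ?thesis by (cases "rho p 2") (simp_all add: wt_def)
  qed
  have D_nxt: "D c p \<le> 1 + D c' (nxt p)" if "p < N" for c c' p
    using that by (auto simp: D_def nxt_def)
  have top: "b * wt (N - 1) = N * b ^ (N - 1)"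
  proof -
    have "N - 1 = Suc (N - 2)" using N by simp
    then show ?thesis using N by (simp add: wt_def)
  qed
  interpret ring_potential N b 0 0 "\<lambda>_. Some 0" "\<lambda>_. 0" wt D "N * b ^ (N - 1) + 1"
  proof unfold_locales
    fix p c
    assume "p < N" "p \<noteq> 2"
    then show "wt (Suc (rho p 2)) + D c p \<le> 1 + b * wt (rho p 2) + D 0 (nxt p)"
      using carry D_nxt[of p c 0] by simp
  qed (use D_nxt top N in \<open>auto simp: D_def wt_def\<close>)
  show ?thesis by (rule le_car) (use n in simp)
qed

text \<open>The control forces the period of the ring to be a multiple of 4: in the states 1, 2, 3 the total
  letter leads to 5, which forbids the partial letter.\<close>

definition ctl_x :: "nat \<Rightarrow> nat option" where
  "ctl_x c = (if c < 3 then Some (c + 1) else if c = 3 \<or> c = 4 then Some 0 else None)"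

definition ctl_y :: "nat \<Rightarrow> nat" where
  "ctl_y c = (if c = 1 \<or> c = 2 \<or> c = 3 then 5 else 4)"

text \<open>Time until digit \<open>r\<close> first becomes 1 in base 4, if an increment takes
  \<open>2 * N\<close> letters when its carry stops at an odd-numbered digit and
  \<open>4 * N\<close> at an even-numbered one.\<close>

fun ctl_wt :: "nat \<Rightarrow> nat \<Rightarrow> nat" where
  "ctl_wt N 0 = 0"
| "ctl_wt N (Suc r) = (if r = 0 then 2 * N else if odd r then 4 * ctl_wt N r + 2 * N else 4 * ctl_wt N r - 2 * N)"

text \<open>The closed form shows growth like \<open>12 * N * 4 ^ r / 5\<close> and that the
  subtraction in \<open>ctl_wt\<close> never truncates. Correction terms stand on both sides to stay
  within the naturals.\<close>

lemma ctl_wt_eq: "5 * ctl_wt N (Suc r) + (if even r then 2 * N else 0) = 12 * N * 4 ^ r + (if odd r then 2 * N else 0)"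
proof (induction r)
  case (Suc r)
  show ?case
  proof (cases "even r")
    case True
    then show ?thesis using Suc by simp
  next
    case False
    then have IH: "5 * ctl_wt N (Suc r) = 12 * N * 4 ^ r + 2 * N" using Suc by simp
    have "N \<le> N * 4 ^ r" by simp
    then have "2 * N \<le> 4 * ctl_wt N (Suc r)" using IH by linarith
    then show ?thesis using IH False by simp
  qed
qed simp

text \<open>The next increment must wait until the marker is at 2 and the control at 0 together.
  Comparing this wait before and after a carry gives the terms \<open>2 * N\<close> of alternating
  sign in \<open>ctl_wt\<close>.\<close>

lemma car_ge_control:
  assumes N: "odd N" "7 \<le> N" and n: "6 * N + 10 \<le> n"
  shows "4 ^ (N + 1) \<le> car n 2"
proof -
  interpret ring N 4 6 4 ctl_x ctl_y
    by unfold_locales (use N in \<open>auto simp: ctl_x_def ctl_y_def split: if_splits\<close>)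
  define \<phi> where "\<phi> i p = (LEAST s. 4 dvd s + i \<and> (p + s) mod N = 2)" for i p
  \<comment> \<open>Control 4 reaches 0 by one partial letter; the default 0 is for control 5, where
    that letter is undefined.\<close>
  define D where "D c p = (if c < 4 then \<phi> c p else if c = 4 then 1 + \<phi> 0 (nxt p) else 0)" for c p
  let ?wt = "ctl_wt N"
  let ?L = "4 * ?wt (N - 1) - 2 * N"
  have \<phi>_ex: "\<exists>s. 4 dvd s + i \<and> (p + s) mod N = 2" if "i < 4" "p < N" for i p
  proof -
    have "(p + (4 - i)) mod N < N" using lt_N by simp
    from ex_shift[OF this lt_N(3)] obtain s where s: "4 dvd s" "((p + (4 - i)) mod N + s) mod N = 2" by (elim exE conjE)
    have "(p + (4 - i + s)) mod N = 2" using s(2) by (simp add: mod_add_left_eq add.assoc)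
    moreover have "4 dvd (4 - i + s) + i" using s(1) that(1) by simp
    ultimately show ?thesis by blast
  qed
  have \<phi>: "4 dvd \<phi> i p + i" "(p + \<phi> i p) mod N = 2" if "i < 4" "p < N" for i p
    using LeastI_ex[OF \<phi>_ex[OF that]] unfolding \<phi>_def by blast+
  have \<phi>_le: "\<phi> i p \<le> s" if "4 dvd s + i" "(p + s) mod N = 2" for i p s
    unfolding \<phi>_def by (rule Least_le) (use that in blast)
  have \<phi>_step: "\<phi> i p \<le> 1 + \<phi> i' (nxt p)" if "i' < 4" "p < N" "4 dvd i + 1 + 3 * i'" for i i' p
  proof (rule \<phi>_le)
    note f = \<phi>[OF that(1) nxt_less[OF that(2)]]
    show "4 dvd 1 + \<phi> i' (nxt p) + i" using f(1) that(3) by presburger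
    show "(p + (1 + \<phi> i' (nxt p))) mod N = 2"
      using f(2) unfolding nxt_mod[OF that(2)] by (simp add: mod_add_left_eq)
  qed
  have \<phi>_upper: "\<phi> 0 p \<le> s" if "p = (2 + 2 * r) mod N" "4 dvd s" "s + 2 * r = k * N" for p r s k
  proof (rule \<phi>_le)
    have "(p + s) mod N = (2 + 2 * r + s) mod N" unfolding that(1) by (rule mod_add_left_eq)
    also have "2 + 2 * r + s = 2 + k * N" using that(3) by simp
    also have "(2 + k * N) mod N = 2" using lt_N(3) by (metis mod_less mod_mult_self1)
    finally show "(p + s) mod N = 2" .
  qed (use that in simp)
  \<comment> \<open>\<open>2 * r + 2\<close> letters of carrying plus the wait \<open>s\<close> make
    \<open>m\<close> full turns. As 4 divides \<open>s\<close> and \<open>N\<close> is odd, 4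
    divides \<open>m\<close> for odd \<open>r\<close>, and 2 divides it for even
    \<open>r\<close>.\<close>
  have \<phi>_lower: "(if odd r then 4 * N else 2 * N) \<le> \<phi> 0 ((4 + 2 * r) mod N) + 2 * r + 2" for r
  proof -
    define s where "s = \<phi> 0 ((4 + 2 * r) mod N)"
    have s: "4 dvd s" "((4 + 2 * r) mod N + s) mod N = 2" using \<phi>[of 0 "(4 + 2 * r) mod N"] lt_N by (auto simp: s_def)
    have "(2 + (2 + 2 * r + s)) mod N = (4 + 2 * r + s) mod N"
      by (rule arg_cong[of _ _ "\<lambda>x. x mod N"]) simp
    also have "\<dots> = 2" using s(2) by (metis mod_add_left_eq)
    finally have "(2 + (2 + 2 * r + s)) mod N = 2" .
    then have "2 + (2 + 2 * r + s) = (2 + (2 + 2 * r + s)) div N * N + 2" by (metis div_mult_mod_eq)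
    then obtain m where m: "2 + 2 * r + s = m * N" by (metis add.commute add_left_cancel)
    show ?thesis
    proof (cases "odd r")
      case True
      then have "4 dvd m * N" unfolding m[symmetric] using s(1) by presburger
      moreover have "coprime 4 N"
        using N(1) by (metis coprime_left_2_iff_odd coprime_power_left_iff num_double numeral_times_numeral power2_eq_square zero_neq_numeral)
      ultimately have "4 dvd m" using coprime_dvd_mult_left_iff by blast
      moreover have "m \<noteq> 0" using m by (intro notI) simp
      ultimately have "4 \<le> m" by (simp add: dvd_imp_le)
      then have "4 * N \<le> m * N" by (rule mult_le_mono1)
      then have "4 * N \<le> s + 2 * r + 2" using m by linarith
      then show ?thesis using True by (simp add: s_def)
    next
      case False
      then have "2 dvd m * N" unfolding m[symmetric] using s(1) by presburger
      then have "2 dvd m" using N(1) by simp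
      moreover have "m \<noteq> 0" using m by (intro notI) simp
      ultimately have "2 \<le> m" by (simp add: dvd_imp_le)
      then have "2 * N \<le> m * N" by (rule mult_le_mono1)
      then have "2 * N \<le> s + 2 * r + 2" using m by linarith
      then show ?thesis using False by (simp add: s_def)
    qed
  qed
  \<comment> \<open>A total letter between two partial ones is possible only from control 0.\<close>
  have c0: "c = 0" if "c \<in> ran ctl_x" "ctl_x (ctl_y c) \<noteq> None" for c
    using that by (auto simp: ran_def ctl_x_def ctl_y_def split: if_splits)
  have D_4: "D 4 p = 1 + \<phi> 0 (nxt p)" and D_0: "D 0 p = \<phi> 0 p" for p
    by (simp_all add: D_def)
  have y0: "ctl_y 0 = 4" by (simp add: ctl_y_def)
  have top: "5 * (4 * ?wt (N - 1)) = 12 * N * 4 ^ (N - 1) + 8 * N"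
  proof -
    have "N - 1 = Suc (N - 2)" "odd (N - 2)" using N by auto
    then have "5 * ?wt (N - 1) = 12 * N * 4 ^ (N - 2) + 2 * N" using ctl_wt_eq[of N "N - 2"] by simp
    moreover have "(4::nat) ^ (N - 1) = 4 * 4 ^ (N - 2)" unfolding \<open>N - 1 = Suc (N - 2)\<close> by simp
    ultimately show ?thesis by simp
  qed
  have top_ge: "2 * N \<le> 4 * ?wt (N - 1)"
  proof -
    have "N \<le> N * 4 ^ (N - 1)" by simp
    then show ?thesis using top by linarith
  qed
  interpret ring_potential N 4 6 4 ctl_x ctl_y ?wt D ?L
  proof unfold_locales
    show "?wt 0 = 0" by simp
  next
    fix p c c' assume p: "p < N" and c: "ctl_x c = Some c'"
    then consider "c < 3" "c' = c + 1" | "c = 3" "c' = 0" | "c = 4" "c' = 0"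
      by (auto simp: ctl_x_def split: if_splits)
    then show "D c p \<le> 1 + D c' (nxt p)"
    proof cases
      case 1
      have "4 dvd c + 1 + 3 * (c + 1)" by presburger
      then show ?thesis using 1 \<phi>_step[OF _ p, of "c + 1" c] by (simp add: D_def)
    next
      case 2
      then show ?thesis using \<phi>_step[OF _ p, of 0 3] by (simp add: D_def)
    next
      case 3
      then show ?thesis by (simp add: D_def)
    qed
  next
    fix c assume "c \<in> ran ctl_x" "ctl_x (ctl_y c) \<noteq> None"
    then have c: "c = 0" by (rule c0)
    have "\<phi> 0 2 \<le> 0" by (rule \<phi>_le) (use lt_N in auto)
    moreover have "2 * N \<le> \<phi> 0 4 + 2" using \<phi>_lower[of 0] lt_N by simp
    ultimately show "?wt 1 + D c 2 \<le> 1 + D (ctl_y c) 3"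
      unfolding c y0 D_4 D_0 by simp
  next
    fix c p assume "c \<in> ran ctl_x" "ctl_x (ctl_y c) \<noteq> None" and p: "p < N" "p \<noteq> 0" "p \<noteq> 2"
    then have c: "c = 0" by (simp add: c0)
    define r where "r = rho p 2"
    have r: "r < N" "p = (2 + 2 * r) mod N" using rho_2_eq[OF p(1)] r_def by blast+
    have r0: "r \<noteq> 0" using rho_0_iff[OF p(1) lt_N(3)] p(3) r_def by simp
    have "nxt (nxt p) = (p + 2) mod N"
      using nxt_mod[OF nxt_less[OF p(1)]] nxt_mod[OF p(1)] by (simp add: mod_Suc_eq)
    also have "\<dots> = ((2 + 2 * r) mod N + 2) mod N" using r(2) by simp
    also have "\<dots> = (2 + 2 * r + 2) mod N" by (rule mod_add_left_eq)
    also have "2 + 2 * r + 2 = 4 + 2 * r" by simp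
    finally have q: "nxt (nxt p) = (4 + 2 * r) mod N" .
    have "?wt (Suc r) + \<phi> 0 p \<le> 2 + 4 * ?wt r + \<phi> 0 (nxt (nxt p))"
    proof (cases "odd r")
      case True
      have "4 dvd 2 * N - 2 * r" using True N(1) r(1) by presburger
      then have "\<phi> 0 p \<le> 2 * N - 2 * r" by (rule \<phi>_upper[OF r(2), where k = 2]) (use r in simp)
      then show ?thesis using True \<phi>_lower[of r] r r0 unfolding q by simp
    next
      case False
      have "4 dvd 4 * N - 2 * r" using False r(1) by presburger
      then have up: "\<phi> 0 p \<le> 4 * N - 2 * r" by (rule \<phi>_upper[OF r(2), where k = 4]) (use r in simp)
      obtain r' where r': "r = Suc r'" "odd r'" using False r0 by (cases r) auto
      have "5 * ?wt r = 12 * N * 4 ^ r' + 2 * N" using ctl_wt_eq[of N r'] r' by simp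
      moreover have "N \<le> N * 4 ^ r'" by simp
      ultimately have "2 * N \<le> 4 * ?wt r" by linarith
      then show ?thesis using False \<phi>_lower[of r] r r0 up unfolding q by simp
    qed
    then show "?wt (Suc (rho p 2)) + D c p \<le> 1 + 4 * ?wt (rho p 2) + D (ctl_y c) (nxt p)"
      unfolding c y0 D_4 D_0 r_def by linarith
  next
    fix c assume "c \<in> ran ctl_x" "ctl_x (ctl_y c) \<noteq> None"
    then have c: "c = 0" by (rule c0)
    have "4 dvd 2 * N + 2" using N(1) by presburger
    moreover have "(2 * N + 2) mod N = 2" using lt_N(3) by (metis add.commute mod_less mod_mult_self1)
    ultimately have "\<phi> 0 0 \<le> 2 * N + 2" by (intro \<phi>_le) simp_all
    then show "?L + D c 0 \<le> 4 * ?wt (N - 1) + D 0 1 + 2"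
      unfolding c D_0 using top_ge by linarith
  qed
  have "?L \<le> car n 2" by (rule le_car) (use n in simp)
  moreover have "4 ^ (N + 1) \<le> ?L"
  proof -
    \<comment> \<open>\<open>84 = 12 * 7\<close>, and \<open>84 / 5\<close> exceeds the factor 16 of
      \<open>4 ^ (N + 1)\<close>; the surplus absorbs the terms linear in \<open>N\<close>.\<close>
    have "84 * 4 ^ (N - 1) \<le> 12 * N * 4 ^ (N - 1)" using N(2) by simp
    moreover have "N - 1 < 4 ^ (N - 1)" by (rule power_gt_expt) simp
    moreover have "(4::nat) ^ (N + 1) = 16 * 4 ^ (N - 1)"
      using power_add[of "4::nat" 2 "N - 1"] N by simp
    ultimately show ?thesis using top by linarith
  qed
  ultimately show ?thesis by linarith
qed

theorem theorem3:
  fixes n k :: nat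
  assumes "n \<ge> 10" and "k > 0" and "n = 6 * k + 4"
  shows "real (car n 2) \<ge> 2 powr ((real n - 4) / 3)"
proof -
  have "4 ^ k \<le> car n 2"
  proof -
    have "k \<le> 5 \<or> k = 6 \<or> 7 \<le> k \<and> odd k \<or> 8 \<le> k \<and> even k" by presburger
    then consider "k \<le> 5" | "k = 6" | "7 \<le> k" "odd k" | "8 \<le> k" "even k" by blast
    then show ?thesis
    proof cases
      case 1
      then have "k = 1 \<or> k = 2 \<or> k = 3 \<or> k = 4 \<or> k = 5" using assms(2) by linarith
      then have "4 ^ k \<le> (n - 1)\<^sup>2" using assms(3) by (elim disjE) simp_all
      also have "\<dots> \<le> car n 2" by (rule car_ge_square) (use assms in simp)
      finally show ?thesis .
    next
      case 2
      \<comment> \<open>Base 3 with ring length 7 needs 39 of the 40 states and gives 5104, above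
        \<open>4 ^ 6 = 4096\<close>.\<close>
      have "7 * 3 ^ (7 - 1) + 1 \<le> car n 2" by (rule car_ge_basic) (use 2 assms in simp_all)
      then show ?thesis using 2 by simp
    next
      case 3
      have "k * 4 ^ (k - 1) + 1 \<le> car n 2" by (rule car_ge_basic) (use 3 assms in simp_all)
      moreover have "4 * 4 ^ (k - 1) \<le> k * 4 ^ (k - 1)" using 3 by simp
      moreover have "(4::nat) ^ k = 4 * 4 ^ (k - 1)" using 3 by (cases k) simp_all
      ultimately show ?thesis by linarith
    next
      case 4
      have "4 ^ (k - 1 + 1) \<le> car n 2" by (rule car_ge_control) (use 4 assms in auto)
      then show ?thesis using 4 by simp
    qed
  qed
  then have "(4::real) ^ k \<le> real (car n 2)" by (metis of_nat_le_iff of_nat_numeral of_nat_power)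
  moreover have "2 powr ((real n - 4) / 3) = (4::real) ^ k"
  proof -
    have "2 powr ((real n - 4) / 3) = 2 powr real (2 * k)" using assms(3) by simp
    also have "\<dots> = 2 ^ (2 * k)" by (rule powr_realpow) simp
    also have "\<dots> = 4 ^ k" by (simp add: power_mult)
    finally show ?thesis .
  qed
  ultimately show ?thesis by simp
qed

end
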